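(* Let $G_1, G_2$ be vertex-disjoint 4-critical planar graphs, each with a fixed embedding in the plane. Let $u_1u_2u_3$ and $v_1v_2v_3$ be paths (each on three distinct vertices) lying in the boundary of some face of $G_1$ and $G_2$, respectively. Let $G=g_4(G_1,G_2)$ be the graph obtained from the disjoint union of $G_1$ and $G_2$ by (a) deleting the edges $u_1u_2$ and $v_1v_2$; (b) adding four new edges $u_1v_1$, $u_2v_3$, $u_3v_2$ and $u_3v_3$. Then $G$ is a 4-critical planar graph.
   Context: Graphs are finite and simple. A graph is $k$-colorable if its vertices can be assigned $k$ colors so that adjacent vertices get different colors; $\chi(G)$ is the least $k$ such that $G$ is $k$-colorable. A graph $G$ is 4-critical if $\chi(G)=4$ and $G-e$ is 3-colorable for every edge $e$ of $G$ (where $G-e$ denotes $G$ with the edge $e$ deleted). A planar graph is a graph that can be embedded in the plane, i.e. drawn so that edges intersect only at their endpoints. *)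

theory Defs
  imports "HOL-Analysis.Analysis"
begin

record 'a sgraph =
  verts :: "'a set"
  edges :: "'a set set"

definition simple_graph :: "'a sgraph \<Rightarrow> bool" where
  "simple_graph G \<longleftrightarrow>
     finite (verts G) \<and> (\<forall>e\<in>edges G. e \<subseteq> verts G \<and> card e = 2)"

definition delete_edge :: "'a sgraph \<Rightarrow> 'a set \<Rightarrow> 'a sgraph" where
  "delete_edge G e = \<lparr>verts = verts G, edges = edges G - {e}\<rparr>"

definition colorable :: "'a sgraph \<Rightarrow> nat \<Rightarrow> bool" where
  "colorable G k \<longleftrightarrow>
     (\<exists>c :: 'a \<Rightarrow> nat. (\<forall>v\<in>verts G. c v < k) \<and> (\<forall>x y. {x, y} \<in> edges G \<longrightarrow> c x \<noteq> c y))"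

definition chromatic_number :: "'a sgraph \<Rightarrow> nat" where
  "chromatic_number G = (LEAST k. colorable G k)"

definition four_critical :: "'a sgraph \<Rightarrow> bool" where
  "four_critical G \<longleftrightarrow>
     chromatic_number G = 4 \<and> (\<forall>e\<in>edges G. colorable (delete_edge G e) 3)"

text \<open>The plane is the type of complex numbers. An embedding consists of the positions
  \<open>p\<close> of the vertices and a parametrised simple arc \<open>c e\<close> for every edge \<open>e\<close>, closed
  at both ends; the direction of the parametrisation is immaterial.\<close>

definition plane_embedding ::
    "'a sgraph \<Rightarrow> ('a \<Rightarrow> complex) \<Rightarrow> ('a set \<Rightarrow> real \<Rightarrow> complex) \<Rightarrow> bool" where
  "plane_embedding G p c \<longleftrightarrow>
     inj_on p (verts G) \<and>
     (\<forall>e\<in>edges G. arc (c e) \<and> {pathstart (c e), pathfinish (c e)} = p ` e) \<and>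
     (\<forall>e\<in>edges G. \<forall>w\<in>verts G. p w \<in> path_image (c e) \<longrightarrow> w \<in> e) \<and>
     (\<forall>e\<in>edges G. \<forall>e'\<in>edges G. e \<noteq> e' \<longrightarrow>
        path_image (c e) \<inter> path_image (c e') \<subseteq> p ` (e \<inter> e'))"

definition planar :: "'a sgraph \<Rightarrow> bool" where
  "planar G \<longleftrightarrow> (\<exists>p c. plane_embedding G p c)"

definition drawing ::
    "'a sgraph \<Rightarrow> ('a \<Rightarrow> complex) \<Rightarrow> ('a set \<Rightarrow> real \<Rightarrow> complex) \<Rightarrow> complex set" where
  "drawing G p c = p ` verts G \<union> (\<Union>e\<in>edges G. path_image (c e))"

definition faces ::
    "'a sgraph \<Rightarrow> ('a \<Rightarrow> complex) \<Rightarrow> ('a set \<Rightarrow> real \<Rightarrow> complex) \<Rightarrow> complex set set" where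
  "faces G p c = components (- drawing G p c)"

text \<open>The arcs contain their end points, so the vertices of the path also lie on the
  boundary of the face.\<close>

definition path3_in_face_boundary ::
    "'a sgraph \<Rightarrow> ('a \<Rightarrow> complex) \<Rightarrow> ('a set \<Rightarrow> real \<Rightarrow> complex) \<Rightarrow> 'a \<Rightarrow> 'a \<Rightarrow> 'a \<Rightarrow> bool" where
  "path3_in_face_boundary G p c x y z \<longleftrightarrow>
     distinct [x, y, z] \<and> {x, y} \<in> edges G \<and> {y, z} \<in> edges G \<and>
     (\<exists>F\<in>faces G p c. path_image (c {x, y}) \<union> path_image (c {y, z}) \<subseteq> frontier F)"

definition g4 ::
    "'a sgraph \<Rightarrow> 'a sgraph \<Rightarrow> 'a \<Rightarrow> 'a \<Rightarrow> 'a \<Rightarrow> 'a \<Rightarrow> 'a \<Rightarrow> 'a \<Rightarrow> 'a sgraph" where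
  "g4 G1 G2 u1 u2 u3 v1 v2 v3 =
     \<lparr>verts = verts G1 \<union> verts G2,
      edges = ((edges G1 \<union> edges G2) - {{u1, u2}, {v1, v2}})
                \<union> {{u1, v1}, {u2, v3}, {u3, v2}, {u3, v3}}\<rparr>"

end

theory Submission
  imports Defs
begin

text \<open>Planarity is obtained from two operations on embeddings. First, if \<open>x\<close> has exactly the
  neighbours \<open>a\<close>, \<open>b\<close>, \<open>d\<close>, then the edge \<open>ad\<close> can be added: slit the plane along the arc
  \<open>\<alpha>\<close> formed by the edges \<open>ax\<close> and \<open>xd\<close>, and open the slit with a branch of
  \<open>sqrt ((z - a) / (z - d))\<close>. The two sides of \<open>\<alpha>\<close> become two different arcs; the edge \<open>xb\<close> arrives
  at one of them, which represents the path \<open>axd\<close>, and the other one is free to represent \<open>ad\<close>.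
  Second, two plane graphs can be glued at vertices of degree three: cut out a small disc around
  each of them, and map what is left of the two drawings into opposite half planes so that
  the three severed edges meet the real axis in the points \<open>0\<close>, \<open>1\<close>, \<open>-1\<close>. No cyclic orders need
  to be compared, because Moebius maps and reflections match any three points.

  The edges \<open>xy\<close>, \<open>yz\<close> of a path on the boundary of a face have interior points \<open>m\<close>, \<open>m'\<close>
  accessible from the face, so they can be subdivided by \<open>m\<close>, \<open>m'\<close> and \<open>m\<close> can be joined to \<open>m'\<close>.
  Since \<open>m'\<close> has degree three, \<open>yz\<close> and \<open>mz\<close> can then be added. Doing this in both graphs, gluing
  at \<open>m\<close> and \<open>n\<close>, and adding \<open>u3 v2\<close> and \<open>u3 v3\<close> at the remaining vertex \<open>n'\<close> of degree three
  gives a graph that contains \<open>g4 G1 G2\<close>.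

  Criticality: every 3-colouring of \<open>G1 - u1 u2\<close> gives \<open>u1\<close> and \<open>u2\<close> the same colour, and
  similarly for \<open>G2\<close>; so in a 3-colouring of \<open>g4 G1 G2\<close> the vertices \<open>u2\<close>, \<open>v2\<close>, \<open>v3\<close> would have
  three different colours, none of which is left for \<open>u3\<close>.\<close>

section \<open>Opening a slit\<close>

text \<open>Whichever branch \<open>f\<close> of the root is taken, its modulus is the square root
  of the modulus of the Moebius map, so \<open>f\<close> tends to 0 at \<open>A\<close> and to
  infinity at \<open>C\<close>; hence \<open>1 / (f + k)\<close> tends to \<open>1 / k\<close> and
  to 0 there. The set \<open>S\<close> is arbitrary because different branches are continuous on
  different pieces of the plane.\<close>

lemma continuous_on_slit_chart:
  fixes A C k :: complex and f :: "complex \<Rightarrow> complex"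
  assumes "A \<noteq> C" "k \<noteq> 0"
    and cont: "continuous_on (S - {A, C}) f"
    and sq: "\<And>z. z \<in> S - {A, C} \<Longrightarrow> (f z)\<^sup>2 = (z - A) / (z - C)"
    and nk: "\<And>z. z \<in> S - {A, C} \<Longrightarrow> f z \<noteq> - k"
  shows "continuous_on S (\<lambda>z. if z = A then 1 / k else if z = C then 0 else 1 / (f z + k))"
    (is "continuous_on S ?\<Psi>")
proof -
  have norm_f: "norm (f z) = sqrt (norm ((z - A) / (z - C)))" if "z \<in> S - {A, C}" for z
    using sq[OF that] by (metis norm_power norm_ge_zero real_sqrt_abs abs_of_nonneg)
  have evS: "\<forall>\<^sub>F z in at w within S. z \<in> S - {A, C}" for w
  proof -
    have "open (- ({A, C} - {w}))" by (intro open_Compl finite_imp_closed) auto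
    then have "\<forall>\<^sub>F z in at w within S. z \<in> - ({A, C} - {w})"
      by (intro topological_tendstoD[OF tendsto_ident_at]) auto
    then show ?thesis
      using eventually_at_filter[of "\<lambda>z. z \<in> S" w S]
      by (auto simp: eventually_at_filter elim: eventually_mono)
  qed
  have ev: "\<forall>\<^sub>F z in at w within S. 1 / (f z + k) = ?\<Psi> z" for w
    using evS[of w] by (rule eventually_mono) auto
  have "(?\<Psi> \<longlongrightarrow> ?\<Psi> w) (at w within S)" if w: "w \<in> S" for w
  proof -
    consider "w = A" | "w = C" | "w \<in> S - {A, C}" using w by blast
    then show ?thesis
    proof cases
      case 1
      have "((\<lambda>z. sqrt (norm ((z - A) / (z - C)))) \<longlongrightarrow> sqrt (norm ((A - A) / (A - C)))) (at w within S)"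
        unfolding 1 using assms(1) by (intro tendsto_intros) auto
      moreover have "\<forall>\<^sub>F z in at w within S. sqrt (norm ((z - A) / (z - C))) = norm (f z)"
        using evS[of w] by (rule eventually_mono) (simp add: norm_f)
      ultimately have "((\<lambda>z. norm (f z)) \<longlongrightarrow> 0) (at w within S)"
        by (simp add: tendsto_cong)
      then have "(f \<longlongrightarrow> 0) (at w within S)"
        by (rule tendsto_norm_zero_cancel)
      then have "((\<lambda>z. 1 / (f z + k)) \<longlongrightarrow> 1 / (0 + k)) (at w within S)"
        using assms(2) by (intro tendsto_intros) auto
      then show ?thesis using ev[of w] 1 by (simp add: tendsto_cong)
    next
      case 2
      \<comment> \<open>At the pole \<open>C\<close> the reciprocal of the root tends to 0, and
        \<open>1 / (f + k)\<close> is a continuous function of that reciprocal.\<close>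
      have "((\<lambda>z. sqrt (norm ((z - C) / (z - A)))) \<longlongrightarrow> sqrt (norm ((C - C) / (C - A)))) (at w within S)"
        unfolding 2 using assms(1) by (intro tendsto_intros) auto
      moreover have "\<forall>\<^sub>F z in at w within S. sqrt (norm ((z - C) / (z - A))) = norm (inverse (f z))"
        using evS[of w] by (rule eventually_mono)
          (simp add: norm_f norm_inverse norm_divide real_sqrt_divide)
      ultimately have "((\<lambda>z. norm (inverse (f z))) \<longlongrightarrow> 0) (at w within S)"
        by (simp add: tendsto_cong)
      then have lim: "((\<lambda>z. inverse (f z)) \<longlongrightarrow> 0) (at w within S)"
        by (rule tendsto_norm_zero_cancel)
      then have "((\<lambda>z. inverse (f z) / (1 + k * inverse (f z))) \<longlongrightarrow> 0 / (1 + k * 0)) (at w within S)"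
        by (intro tendsto_intros) auto
      moreover have "\<forall>\<^sub>F z in at w within S. inverse (f z) / (1 + k * inverse (f z)) = ?\<Psi> z"
        using evS[of w]
      proof (rule eventually_mono)
        fix z assume z: "z \<in> S - {A, C}"
        then have "f z \<noteq> 0" using sq[OF z] by auto
        then show "inverse (f z) / (1 + k * inverse (f z)) = ?\<Psi> z"
          using z nk[OF z] by (auto simp: field_simps)
      qed
      ultimately show ?thesis using 2 assms(1) by (simp add: tendsto_cong)
    next
      case 3
      have "(f \<longlongrightarrow> f w) (at w within S - {A, C})"
        using cont 3 by (auto simp: continuous_on_def)
      moreover have "at w within S - {A, C} = at w within S"
      proof -
        have "open (- {A, C})" by (intro open_Compl finite_imp_closed) auto
        then show ?thesis using 3 by (intro at_within_nhd[of w "- {A, C}"]) auto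
      qed
      ultimately have "(f \<longlongrightarrow> f w) (at w within S)" by simp
      then have "((\<lambda>z. 1 / (f z + k)) \<longlongrightarrow> 1 / (f w + k)) (at w within S)"
        using nk[OF 3] by (intro tendsto_intros) (auto simp: add_eq_0_iff2)
      then show ?thesis using ev[of w] 3 by (simp add: tendsto_cong)
    qed
  qed
  then show ?thesis by (simp add: continuous_on_def)
qed

text \<open>As \<open>t\<close> runs from 0 to 1, the maps \<open>(z - g 0) / (z - g t)\<close>
  deform the constant 1 into the Moebius map without a zero or a pole off the path. So the Moebius
  map has a continuous logarithm there, and the exponential of half of it is the root.\<close>

lemma continuous_sqrt_off_arc:
  fixes g :: "real \<Rightarrow> complex"
  assumes "path g"
  obtains f where "continuous_on (- path_image g) f"
    "\<And>z. z \<notin> path_image g \<Longrightarrow> (f z)\<^sup>2 = (z - pathstart g) / (z - pathfinish g)"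
proof -
  let ?S = "- path_image g"
  define h where "h \<equiv> \<lambda>y. (snd y - pathstart g) / (snd y - (g \<circ> fst) y)"
  have "continuous_on ({0..1} \<times> ?S) h"
    unfolding h_def using assms by (intro continuous_intros) (auto simp: path_defs)
  moreover have "h \<in> ({0..1} \<times> ?S) \<rightarrow> - {0}"
    unfolding h_def by (auto simp: path_defs)
  ultimately have 1: "homotopic_with_canon (\<lambda>h. True) ?S (- {0}) (\<lambda>z. (z - pathstart g) / (z - pathstart g))
          (\<lambda>z. (z - pathstart g) / (z - pathfinish g))"
    by (auto simp: h_def path_defs homotopic_with_def)
  have 2: "homotopic_with_canon (\<lambda>h. True) ?S (- {0}) (\<lambda>z. 1) (\<lambda>z. (z - pathstart g) / (z - pathstart g))"
    using pathstart_in_path_image[of g] by (intro homotopic_with_equal) (auto intro!: continuous_intros)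
  have "homotopic_with_canon (\<lambda>h. True) ?S (- {0}) (\<lambda>z. (z - pathstart g) / (z - pathfinish g)) (\<lambda>z. 1)"
    by (rule homotopic_with_trans[OF homotopic_with_symD[OF 1] homotopic_with_symD[OF 2]])
  then obtain l where l: "continuous_on ?S l" "\<And>z. z \<in> ?S \<Longrightarrow> (z - pathstart g) / (z - pathfinish g) = exp (l z)"
    using iffD1[OF inessential_eq_continuous_logarithm, OF exI] by blast
  show ?thesis
  proof
    show "continuous_on ?S (\<lambda>z. exp (l z / 2))"
      by (intro continuous_intros l(1)) simp
    show "(exp (l z / 2))\<^sup>2 = (z - pathstart g) / (z - pathfinish g)" if "z \<notin> path_image g" for z
      using l(2)[of z] that by (simp flip: exp_double)
  qed
qed

lemma contractible_arc_image: "arc g \<Longrightarrow> contractible (path_image (g :: real \<Rightarrow> complex))"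
  by (metis convex_imp_contractible convex_real_interval(5) homeomorphic_arc_image_interval homeomorphic_contractible homeomorphic_sym zero_less_one)

text \<open>The Moebius map has its zero and its pole at the ends of the slit; on the contractible
  rest of the slit it has a continuous square root.\<close>

lemma contractible_arc_interior:
  fixes g :: "real \<Rightarrow> complex"
  assumes "arc g" shows "contractible (path_image g - {pathstart g, pathfinish g})"
proof -
  obtain h where h: "homeomorphism {0..1} (path_image g) g h"
    using homeomorphism_arc[OF assms] .
  have "g ` {0<..<1} = path_image g - {pathstart g, pathfinish g}"
    using simple_path_endless[OF arc_imp_simple_path[OF assms]] by simp
  then have "homeomorphism {0<..<1} (path_image g - {pathstart g, pathfinish g}) g h"
    by (intro homeomorphism_of_subsets[OF h]) auto
  then show ?thesis
    using homeomorphic_contractible[of "{0<..<1::real}"] convex_imp_contractible[of "{0<..<1::real}"]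
    by (auto simp: homeomorphic_def)
qed

text \<open>In the slit construction this set is the part of \<beta> off the slit. Its connectedness
  forces two roots along it to differ by a constant sign.\<close>

lemma connected_arc_minus_start:
  fixes g :: "real \<Rightarrow> complex"
  assumes "arc g" shows "connected (path_image g - {pathstart g})"
proof -
  have inj: "inj_on g {0..1}" using assms by (simp add: arc_def)
  have "{0..1} - {0} = {0<..1::real}" by auto
  then have "path_image g - {pathstart g} = g ` {0<..1}"
    using inj_on_image_set_diff[OF inj, of "{0..1}" "{0}"] by (auto simp: path_defs)
  moreover have "continuous_on {0<..1} g"
    using assms by (auto simp: arc_def path_def elim!: continuous_on_subset)
  ultimately show ?thesis by (simp add: connected_continuous_image)
qed

text \<open>On the slit, \<Psi> is built from the root that continues the root along \<beta>, and
  \<gamma> from the opposite one. As \<Psi> jumps across the slit, its continuity is stated on three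
  sets separately; every edge of the graph to be redrawn will lie in one of them.\<close>

lemma slit_opening:
  fixes \<alpha> \<beta> :: "real \<Rightarrow> complex"
  assumes \<alpha>: "arc \<alpha>" and \<beta>: "arc \<beta>"
    and ends: "pathstart \<beta> \<noteq> pathstart \<alpha>" "pathstart \<beta> \<noteq> pathfinish \<alpha>"
    and meet: "path_image \<beta> \<inter> path_image \<alpha> = {pathstart \<beta>}"
  obtains \<Psi> :: "complex \<Rightarrow> complex" and \<gamma> where "inj \<Psi>"
    "continuous_on (- path_image \<alpha> \<union> {pathstart \<alpha>, pathfinish \<alpha>}) \<Psi>"
    "continuous_on (path_image \<alpha>) \<Psi>" "continuous_on (path_image \<beta>) \<Psi>"
    "arc \<gamma>" "pathstart \<gamma> = \<Psi> (pathstart \<alpha>)" "pathfinish \<gamma> = \<Psi> (pathfinish \<alpha>)"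
    "path_image \<gamma> \<inter> range \<Psi> \<subseteq> {\<Psi> (pathstart \<alpha>), \<Psi> (pathfinish \<alpha>)}"
proof -
  define A C X where "A = pathstart \<alpha>" and "C = pathfinish \<alpha>" and "X = pathstart \<beta>"
  define M where "M = (\<lambda>z. (z - A) / (z - C))"
  have AC: "A \<noteq> C" using \<alpha> by (metis A_def C_def arc_distinct_ends)
  have in_\<alpha>: "A \<in> path_image \<alpha>" "C \<in> path_image \<alpha>" "X \<in> path_image \<alpha>" "X \<in> path_image \<beta>"
    using meet by (auto simp: A_def C_def X_def)
  have XAC: "X \<noteq> A" "X \<noteq> C" using ends by (auto simp: A_def C_def X_def)
  have M0: "M z \<noteq> 0" if "z \<notin> {A, C}" for z using that by (auto simp: M_def)
  have M_inj: "z = z'" if "M z = M z'" "z \<notin> {A, C}" "z' \<notin> {A, C}" for z z'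
  proof -
    have "(z - A) * (z' - C) = (z' - A) * (z - C)"
      using that by (auto simp: M_def divide_simps)
    then have "(A - C) * (z - z') = 0" by (simp add: algebra_simps)
    then show ?thesis using AC by simp
  qed
  have cM: "continuous_on S M" if "C \<notin> S" for S
    using that unfolding M_def by (intro continuous_intros) auto
  obtain \<phi> where \<phi>: "continuous_on (- path_image \<alpha>) \<phi>" "\<And>z. z \<notin> path_image \<alpha> \<Longrightarrow> (\<phi> z)\<^sup>2 = M z"
    using continuous_sqrt_off_arc[OF arc_imp_path[OF \<alpha>]] by (auto simp: M_def A_def C_def)
  obtain \<sigma>0 where \<sigma>0: "continuous_on (path_image \<alpha> - {A, C}) \<sigma>0"
      "\<And>z. z \<in> path_image \<alpha> - {A, C} \<Longrightarrow> M z = (\<sigma>0 z)\<^sup>2"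
    using continuous_sqrt_on_contractible[OF cM contractible_arc_interior[OF \<alpha>]] M0
    by (auto simp: A_def C_def)
  have \<beta>AC: "A \<notin> path_image \<beta>" "C \<notin> path_image \<beta>"
  proof -
    have "z = X" if "z \<in> path_image \<beta>" "z \<in> path_image \<alpha>" for z
    proof -
      have "z \<in> path_image \<beta> \<inter> path_image \<alpha>" using that by blast
      then show ?thesis unfolding meet X_def by simp
    qed
    then show "A \<notin> path_image \<beta>" "C \<notin> path_image \<beta>" using XAC in_\<alpha> by blast+
  qed
  obtain f where f: "continuous_on (path_image \<beta>) f" "\<And>z. z \<in> path_image \<beta> \<Longrightarrow> M z = (f z)\<^sup>2"
    using continuous_sqrt_on_contractible[OF cM[OF \<beta>AC(2)] contractible_arc_image[OF \<beta>]] M0 \<beta>AC(1)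
    by (metis \<beta>AC(2) insertE singletonD)
  let ?B = "path_image \<beta> - {X}"
  have B: "z \<notin> path_image \<alpha>" "z \<in> path_image \<beta>" "z \<notin> {A, C}" if "z \<in> ?B" for z
  proof -
    show "z \<in> path_image \<beta>" "z \<notin> {A, C}" using that \<beta>AC by auto
    show "z \<notin> path_image \<alpha>" using that meet X_def by (metis DiffE IntI)
  qed
  \<comment> \<open>Both are roots of \<open>M\<close>, so the quotient takes only the values 1 and
    -1.\<close>
  have "(\<lambda>z. \<phi> z / f z) constant_on ?B"
  proof (rule continuous_finite_range_constant)
    show "connected ?B" using connected_arc_minus_start[OF \<beta>] by (simp add: X_def)
    show "continuous_on ?B (\<lambda>z. \<phi> z / f z)"
    proof (rule continuous_on_divide)
      show "continuous_on ?B \<phi>" using B by (intro continuous_on_subset[OF \<phi>(1)]) blast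
      show "continuous_on ?B f" using B by (intro continuous_on_subset[OF f(1)]) blast
      have "f z \<noteq> 0" if "z \<in> ?B" for z
        using f(2)[OF B(2)[OF that]] M0[OF B(3)[OF that]] by auto
      then show "\<forall>z\<in>?B. f z \<noteq> 0" by blast
    qed
    have "\<phi> z / f z \<in> {1, -1}" if "z \<in> ?B" for z
    proof -
      have "(\<phi> z)\<^sup>2 = (f z)\<^sup>2" "f z \<noteq> 0"
        using \<phi>(2)[OF B(1)[OF that]] f(2)[OF B(2)[OF that]] M0[OF B(3)[OF that]] by auto
      then show ?thesis by (auto simp: power2_eq_iff)
    qed
    then have "(\<lambda>z. \<phi> z / f z) ` ?B \<subseteq> {1, -1}" by (rule image_subsetI)
    then show "finite ((\<lambda>z. \<phi> z / f z) ` ?B)"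
      by (rule finite_subset) simp
  qed
  then obtain e where e: "\<And>z. z \<in> ?B \<Longrightarrow> \<phi> z / f z = e" by (auto simp: constant_on_def)
  \<comment> \<open>The root along \<beta> with its sign corrected to match \<phi> off the slit. For
    empty \<open>?B\<close> nothing is known about \<open>e\<close>, so \<open>f\<close> is
    kept.\<close>
  define f' where "f' = (\<lambda>z. if ?B = {} then f z else e * f z)"
  have f'\<phi>: "f' z = \<phi> z" if "z \<in> ?B" for z
  proof -
    have "f z \<noteq> 0" using f(2)[OF B(2)[OF that]] M0[OF B(3)[OF that]] by auto
    then show ?thesis using e[OF that] that by (auto simp: f'_def)
  qed
  have f'c: "continuous_on (path_image \<beta>) f'"
    unfolding f'_def by (cases "?B = {}") (auto intro!: continuous_intros f(1))
  have f'M: "(f' z)\<^sup>2 = M z" if "z \<in> path_image \<beta>" for z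
  proof (cases "?B = {}")
    case False
    then obtain y where y: "y \<in> ?B" by blast
    have "(\<phi> y)\<^sup>2 = (f y)\<^sup>2" "f y \<noteq> 0"
      using \<phi>(2)[OF B(1)[OF y]] f(2)[OF B(2)[OF y]] M0[OF B(3)[OF y]] by auto
    then have "e\<^sup>2 = 1" using e[OF y] by (auto simp: power_divide)
    then show ?thesis using False f(2)[OF that] by (simp add: f'_def power_mult_distrib)
  qed (use f(2) that in \<open>simp add: f'_def\<close>)
  \<comment> \<open>The sign of the root along \<alpha> is fixed by matching \<open>f'\<close> at
    the junction \<open>X\<close>; this selects the side of the slit at which \<beta>
    arrives.\<close>
  define \<sigma> where "\<sigma> = (\<lambda>z. if \<sigma>0 X = f' X then \<sigma>0 z else - \<sigma>0 z)"
  have \<sigma>M: "(\<sigma> z)\<^sup>2 = M z" if "z \<in> path_image \<alpha> - {A, C}" for z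
    using \<sigma>0(2)[OF that] by (simp add: \<sigma>_def)
  have \<sigma>c: "continuous_on (path_image \<alpha> - {A, C}) \<sigma>"
    unfolding \<sigma>_def by (cases "\<sigma>0 X = f' X") (auto intro!: continuous_intros \<sigma>0(1))
  have \<sigma>X: "\<sigma> X = f' X"
  proof -
    have "(\<sigma>0 X)\<^sup>2 = (f' X)\<^sup>2" using f'M[of X] \<sigma>0(2)[of X] in_\<alpha> XAC by simp
    then show ?thesis by (auto simp: \<sigma>_def power2_eq_iff)
  qed
  define \<Phi> where "\<Phi> = (\<lambda>z. if z \<in> path_image \<alpha> then \<sigma> z else \<phi> z)"
  have \<Phi>M: "(\<Phi> z)\<^sup>2 = M z" if "z \<notin> {A, C}" for z
    using that \<sigma>M[of z] \<phi>(2)[of z] by (auto simp: \<Phi>_def)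
  obtain z0 where z0: "z0 \<notin> path_image \<alpha>"
    using compact_path_image[OF arc_imp_path[OF \<alpha>]] not_compact_UNIV[where 'a = complex]
    by (metis UNIV_eq_I)
  have z0AC: "z0 \<notin> {A, C}" using z0 in_\<alpha> by auto
  \<comment> \<open>The other value \<open>-k\<close> of the root at \<open>z0\<close> is not attained by the chosen branch, so it can be
    sent to infinity, which moves the image of \<open>C\<close> to a finite point.\<close>
  define k where "k = \<phi> z0"
  have k2: "k\<^sup>2 = M z0" using \<phi>(2)[OF z0] by (simp add: k_def)
  have k0: "k \<noteq> 0" using k2 M0[OF z0AC] by auto
  have nk: "\<Phi> z \<noteq> - k" if "z \<notin> {A, C}" for z
  proof
    assume eq: "\<Phi> z = - k"
    then have "z = z0" using \<Phi>M[OF that] k2 by (intro M_inj[OF _ that z0AC]) simp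
    then show False using eq k0 z0 by (simp add: \<Phi>_def k_def)
  qed
  have nk': "- \<sigma> z \<noteq> - k" if "z \<in> path_image \<alpha> - {A, C}" for z
  proof
    assume eq: "- \<sigma> z = - k"
    then have "z = z0" using \<sigma>M[OF that] k2 that by (intro M_inj[OF _ _ z0AC]) auto
    then show False using that z0 by auto
  qed
  define chart where "chart = (\<lambda>f z. if z = A then 1 / k else if z = C then 0 else 1 / (f z + k))"
  have chart_cont: "continuous_on S (chart f)"
    if "continuous_on (S - {A, C}) f" "\<And>z. z \<in> S - {A, C} \<Longrightarrow> (f z)\<^sup>2 = M z"
      "\<And>z. z \<in> S - {A, C} \<Longrightarrow> f z \<noteq> - k" for S f
    unfolding chart_def using that by (intro continuous_on_slit_chart AC k0) (auto simp: M_def)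
  have \<Phi>_cont: "continuous_on S (chart \<Phi>)" if "continuous_on (S - {A, C}) \<Phi>" for S
    using that \<Phi>M nk by (intro chart_cont) auto
  have eq0: "z = w"
    if eq: "chart f z = chart g w"
      and f: "z \<notin> {A, C} \<Longrightarrow> (f z)\<^sup>2 = M z" "z \<notin> {A, C} \<Longrightarrow> f z \<noteq> - k"
      and g: "w \<notin> {A, C} \<Longrightarrow> (g w)\<^sup>2 = M w" "w \<notin> {A, C} \<Longrightarrow> g w \<noteq> - k" for f g z w
  proof -
    have fz: "f z + k \<noteq> 0" "f z \<noteq> 0" "chart f z = 1 / (f z + k)" if "z \<notin> {A, C}"
      using f that M0[OF that] by (auto simp: add_eq_0_iff2 chart_def)
    have gw: "g w + k \<noteq> 0" "g w \<noteq> 0" "chart g w = 1 / (g w + k)" if "w \<notin> {A, C}"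
      using g that M0[OF that] by (auto simp: add_eq_0_iff2 chart_def)
    have AC': "chart h A = 1 / k" "chart h C = 0" for h using AC by (auto simp: chart_def)
    consider "z \<in> {A, C}" "w \<in> {A, C}" | "z \<in> {A, C}" "w \<notin> {A, C}"
      | "z \<notin> {A, C}" "w \<in> {A, C}" | "z \<notin> {A, C}" "w \<notin> {A, C}" by blast
    then show ?thesis
    proof cases
      case 1
      then show ?thesis using eq AC' k0 by auto
    next
      case 2
      then have "g w + k = k" using eq AC' gw k0 AC by (auto simp: chart_def divide_simps split: if_splits)
      then show ?thesis using gw(2)[OF 2(2)] by simp
    next
      case 3
      then have "f z + k = k" using eq AC' fz k0 AC by (auto simp: chart_def divide_simps split: if_splits)
      then show ?thesis using fz(2)[OF 3(1)] by simp
    next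
      case 4
      then have "f z + k = g w + k"
        using eq fz gw by (simp add: divide_simps)
      then have "M z = M w" using f(1) g(1) 4 by simp
      then show ?thesis using 4 by (rule M_inj)
    qed
  qed
  have inj: "inj (chart \<Phi>)"
  proof (rule injI)
    show "z = w" if "chart \<Phi> z = chart \<Phi> w" for z w
      using that by (rule eq0) (use \<Phi>M nk in auto)
  qed
  \<comment> \<open>The opposite root along \<alpha> traces the free side of the slit.\<close>
  define \<gamma> where "\<gamma> = chart (\<lambda>z. - \<sigma> z) \<circ> \<alpha>"
  have \<sigma>_cont: "continuous_on (path_image \<alpha>) (chart (\<lambda>z. - \<sigma> z))"
    using \<sigma>c \<sigma>M nk' by (intro chart_cont continuous_intros) auto
  have \<sigma>_inj: "inj_on (chart (\<lambda>z. - \<sigma> z)) (path_image \<alpha>)"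
  proof (rule inj_onI)
    show "z = w" if "z \<in> path_image \<alpha>" "w \<in> path_image \<alpha>"
      "chart (\<lambda>z. - \<sigma> z) z = chart (\<lambda>z. - \<sigma> z) w" for z w
      using that \<sigma>M nk' by (intro eq0[OF that(3)]) auto
  qed
  show ?thesis
  proof (rule that)
    show "inj (chart \<Phi>)" by (rule inj)
    show "continuous_on (- path_image \<alpha> \<union> {pathstart \<alpha>, pathfinish \<alpha>}) (chart \<Phi>)"
    proof (rule \<Phi>_cont, rule continuous_on_eq[OF continuous_on_subset[OF \<phi>(1)]])
      show "- path_image \<alpha> \<union> {pathstart \<alpha>, pathfinish \<alpha>} - {A, C} \<subseteq> - path_image \<alpha>"
        by (auto simp: A_def C_def)
      then show "\<phi> z = \<Phi> z" if "z \<in> - path_image \<alpha> \<union> {pathstart \<alpha>, pathfinish \<alpha>} - {A, C}" for z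
        using that by (auto simp: \<Phi>_def)
    qed
    show "continuous_on (path_image \<alpha>) (chart \<Phi>)"
      by (rule \<Phi>_cont, rule continuous_on_eq[OF \<sigma>c]) (simp add: \<Phi>_def)
    have "continuous_on (path_image \<beta>) \<Phi>"
    proof (rule continuous_on_eq[OF f'c])
      show "f' z = \<Phi> z" if "z \<in> path_image \<beta>" for z
        using f'\<phi>[of z] B(1)[of z] \<sigma>X in_\<alpha>(3) that by (cases "z = X") (simp_all add: \<Phi>_def)
    qed
    then show "continuous_on (path_image \<beta>) (chart \<Phi>)"
      by (intro \<Phi>_cont) (auto elim: continuous_on_subset)
    show "arc \<gamma>"
      using \<alpha> \<sigma>_cont \<sigma>_inj unfolding \<gamma>_def
      by (auto simp: arc_def path_image_def comp_inj_on intro!: path_continuous_image)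
    show "pathstart \<gamma> = chart \<Phi> (pathstart \<alpha>)" "pathfinish \<gamma> = chart \<Phi> (pathfinish \<alpha>)"
      by (auto simp: \<gamma>_def chart_def A_def C_def pathstart_compose pathfinish_compose)
    show "path_image \<gamma> \<inter> range (chart \<Phi>) \<subseteq> {chart \<Phi> (pathstart \<alpha>), chart \<Phi> (pathfinish \<alpha>)}"
    proof
      fix y assume "y \<in> path_image \<gamma> \<inter> range (chart \<Phi>)"
      then obtain z w where z: "z \<in> path_image \<alpha>" "y = chart (\<lambda>z. - \<sigma> z) z" and w: "y = chart \<Phi> w"
        by (auto simp: \<gamma>_def path_image_compose)
      show "y \<in> {chart \<Phi> (pathstart \<alpha>), chart \<Phi> (pathfinish \<alpha>)}"
      proof (cases "z \<in> {A, C}")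
        case True
        then show ?thesis using z AC by (auto simp: chart_def A_def C_def)
      next
        case False
        then have fz: "(- \<sigma> z)\<^sup>2 = M z" "- \<sigma> z + k \<noteq> 0" "\<sigma> z \<noteq> 0"
          using z \<sigma>M[of z] nk'[of z] M0[of z] by (auto simp: add_eq_0_iff2)
        \<comment> \<open>A common value would make the two opposite roots at one point of the slit
          equal, hence zero, which is excluded between the ends.\<close>
        have "chart (\<lambda>z. - \<sigma> z) z = chart \<Phi> w" using z w by simp
        then have "z = w"
          by (rule eq0) (use z \<sigma>M nk' \<Phi>M nk in auto)
        then have "1 / (- \<sigma> z + k) = 1 / (\<sigma> z + k)" "\<sigma> z + k \<noteq> 0"
          using z w False nk[of z] by (auto simp: chart_def \<Phi>_def add_eq_0_iff2)
        then have "\<sigma> z = 0" using fz(2) by (simp add: divide_simps eq_neg_iff_add_eq_0)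
        then show ?thesis using fz by simp
      qed
    qed
  qed
qed

section \<open>Operations on plane embeddings\<close>

lemma plane_embedding_edgeD:
  assumes "plane_embedding G p c" "e \<in> edges G"
  shows "arc (c e)" "{pathstart (c e), pathfinish (c e)} = p ` e"
    "p w \<in> path_image (c e) \<Longrightarrow> w \<in> verts G \<Longrightarrow> w \<in> e"
    "e' \<in> edges G \<Longrightarrow> e \<noteq> e' \<Longrightarrow> path_image (c e) \<inter> path_image (c e') \<subseteq> p ` (e \<inter> e')"
  using assms by (simp_all add: plane_embedding_def)

lemma plane_embedding_inj: "plane_embedding G p c \<Longrightarrow> inj_on p (verts G)"
  by (simp add: plane_embedding_def)

lemma oriented_edge:
  assumes "plane_embedding G p c" "{x, y} \<in> edges G"
  obtains g where "arc g" "pathstart g = p x" "pathfinish g = p y" "path_image g = path_image (c {x, y})"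
proof -
  have "arc (c {x, y})" "{pathstart (c {x, y}), pathfinish (c {x, y})} = {p x, p y}"
    using plane_embedding_edgeD[OF assms] by auto
  then show ?thesis
    using that[of "c {x, y}"] that[of "reversepath (c {x, y})"]
    by (auto simp: doubleton_eq_iff arc_reversepath)
qed

lemma plane_embedding_subgraph:
  assumes "plane_embedding G p c" "verts H \<subseteq> verts G" "edges H \<subseteq> edges G"
  shows "plane_embedding H p c"
proof -
  have "inj_on p (verts H)" using assms(2) plane_embedding_def[of G] assms(1) by (auto intro: inj_on_subset)
  moreover have "e \<in> edges G" if "e \<in> edges H" for e using that assms(3) by auto
  moreover have "w \<in> verts G" if "w \<in> verts H" for w using that assms(2) by auto
  ultimately show ?thesis using assms(1) by (simp add: plane_embedding_def)
qed

lemma planar_subgraph: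
  "planar G \<Longrightarrow> verts H \<subseteq> verts G \<Longrightarrow> edges H \<subseteq> edges G \<Longrightarrow> planar H"
  unfolding planar_def using plane_embedding_subgraph by blast

text \<open>Every clause of an embedding concerns single arcs or incidences of points, so
  injectivity on the drawing and continuity along each edge suffice. This admits \<Psi>, which jumps
  across the slit.\<close>

lemma plane_embedding_transport:
  assumes G: "plane_embedding G p c"
    and inj: "inj_on f (drawing G p c)"
    and cont: "\<And>e. e \<in> edges G \<Longrightarrow> continuous_on (path_image (c e)) f"
  shows "plane_embedding G (f \<circ> p) (\<lambda>e. f \<circ> c e)"
  unfolding plane_embedding_def
proof (intro conjI ballI impI)
  have D: "p v \<in> drawing G p c" if "v \<in> verts G" for v using that by (auto simp: drawing_def)
  have De: "path_image (c e) \<subseteq> drawing G p c" if "e \<in> edges G" for e using that by (auto simp: drawing_def)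
  show "inj_on (f \<circ> p) (verts G)"
    using plane_embedding_inj[OF G]
    by (rule comp_inj_on) (rule inj_on_subset[OF inj], auto simp: drawing_def)
  fix e assume e: "e \<in> edges G"
  note E = plane_embedding_edgeD[OF G e]
  show "arc (f \<circ> c e)"
    using E(1) cont[OF e] inj_on_subset[OF inj De[OF e]]
    by (auto simp: arc_def path_image_def intro!: path_continuous_image comp_inj_on)
  show "{pathstart (f \<circ> c e), pathfinish (f \<circ> c e)} = (f \<circ> p) ` e"
    using arg_cong[OF E(2), of "image f"] by (simp add: pathstart_compose pathfinish_compose image_comp)
  show "w \<in> e" if w: "w \<in> verts G" "(f \<circ> p) w \<in> path_image (f \<circ> c e)" for w
  proof -
    obtain z where z: "z \<in> path_image (c e)" "f (p w) = f z" using w(2) unfolding path_image_compose o_apply by blast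
    then have "p w = z" using inj_onD[OF inj, of "p w" z] D[OF w(1)] De[OF e] by blast
    then show ?thesis using E(3) z w by blast
  qed
  fix e' assume e': "e' \<in> edges G" "e \<noteq> e'"
  show "path_image (f \<circ> c e) \<inter> path_image (f \<circ> c e') \<subseteq> (f \<circ> p) ` (e \<inter> e')"
  proof
    fix y assume "y \<in> path_image (f \<circ> c e) \<inter> path_image (f \<circ> c e')"
    then obtain z z' where z: "z \<in> path_image (c e)" "z' \<in> path_image (c e')" "y = f z" "y = f z'"
      unfolding path_image_compose by blast
    then have "z = z'" using inj_onD[OF inj, of z z'] De[OF e] De[OF e'(1)] by blast
    then have "z \<in> p ` (e \<inter> e')" using E(4)[OF e'] z by blast
    then show "y \<in> (f \<circ> p) ` (e \<inter> e')" using z by auto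
  qed
qed

lemma plane_embedding_insert_edge:
  assumes G: "plane_embedding G p c"
    and ab: "a \<in> verts G" "b \<in> verts G"
    and \<gamma>: "arc \<gamma>" "pathstart \<gamma> = p a" "pathfinish \<gamma> = p b"
    and meet: "path_image \<gamma> \<inter> drawing G p c \<subseteq> {p a, p b}"
    and simple: "simple_graph G"
    and new: "{a, b} \<notin> edges G"
  shows "plane_embedding \<lparr>verts = verts G, edges = insert {a, b} (edges G)\<rparr> p (c({a, b} := \<gamma>))"
proof -
  have 1: "path_image \<gamma> \<inter> path_image (c e) \<subseteq> p ` ({a, b} \<inter> e)" if e: "e \<in> edges G" for e
  proof
    fix z assume z: "z \<in> path_image \<gamma> \<inter> path_image (c e)"
    then have "z \<in> {p a, p b}" using meet e by (auto simp: drawing_def)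
    then obtain w where w: "w \<in> {a, b}" "z = p w" by auto
    then have "w \<in> e" using plane_embedding_edgeD(3)[OF G e, of w] z ab by auto
    then show "z \<in> p ` ({a, b} \<inter> e)" using w by auto
  qed
  have 2: "w \<in> {a, b}" if "w \<in> verts G" "p w \<in> path_image \<gamma>" for w
  proof -
    have "p w \<in> {p a, p b}" using that meet by (auto simp: drawing_def)
    then show ?thesis using plane_embedding_inj[OF G] that ab by (auto dest: inj_onD)
  qed
  have 3: "e \<noteq> {a, b}" if "e \<in> edges G" for e using that new by auto
  show ?thesis
    unfolding plane_embedding_def sgraph.simps
  proof (intro conjI ballI impI)
    show "inj_on p (verts G)" by (rule plane_embedding_inj[OF G])
    fix e assume e: "e \<in> insert {a, b} (edges G)"
    show "arc ((c({a, b} := \<gamma>)) e)"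
      using e \<gamma> plane_embedding_edgeD(1)[OF G] by auto
    show "{pathstart ((c({a, b} := \<gamma>)) e), pathfinish ((c({a, b} := \<gamma>)) e)} = p ` e"
      using e \<gamma> plane_embedding_edgeD(2)[OF G] by auto
    show "w \<in> e" if "w \<in> verts G" "p w \<in> path_image ((c({a, b} := \<gamma>)) e)" for w
      using e that 2[of w] plane_embedding_edgeD(3)[OF G, of e w] by (auto split: if_splits)
    fix e' assume e': "e' \<in> insert {a, b} (edges G)" "e \<noteq> e'"
    show "path_image ((c({a, b} := \<gamma>)) e) \<inter> path_image ((c({a, b} := \<gamma>)) e') \<subseteq> p ` (e \<inter> e')"
    proof (cases "e = {a, b}")
      case True
      then show ?thesis using 1[of e'] e' by auto
    next
      case False
      then have eG: "e \<in> edges G" using e by auto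
      show ?thesis
      proof (cases "e' = {a, b}")
        case True
        then show ?thesis using 1[OF eG] False by (simp add: Int_commute)
      next
        case False
        then show ?thesis
          using plane_embedding_edgeD(4)[OF G eG] e' \<open>e \<noteq> {a, b}\<close> by simp
      qed
    qed
  qed
qed

text \<open>Any two of the three neighbours are consecutive around \<open>x\<close>, so no rotation
  has to be known. The slit is \<open>a x d\<close> and \<beta> is \<open>x b\<close>. An edge
  avoiding \<open>x\<close> meets the slit at most in \<open>p a\<close> and \<open>p d\<close>, so
  \<Psi> is continuous along every edge.\<close>

lemma planar_insert_edge_at_degree_3:
  assumes simple: "simple_graph G" and planar: "planar G"
    and star: "{e \<in> edges G. x \<in> e} = {{x, a}, {x, b}, {x, d}}"
    and distinct: "distinct [x, a, b, d]"
    and new: "{a, d} \<notin> edges G"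
  shows "planar \<lparr>verts = verts G, edges = insert {a, d} (edges G)\<rparr>"
proof -
  obtain p c where G: "plane_embedding G p c" using planar by (auto simp: planar_def)
  have E: "{x, a} \<in> edges G" "{x, b} \<in> edges G" "{x, d} \<in> edges G" using star by auto
  then have V: "x \<in> verts G" "a \<in> verts G" "b \<in> verts G" "d \<in> verts G"
    using simple by (auto simp: simple_graph_def)
  have p: "p v = p w \<longleftrightarrow> v = w" if "v \<in> {x, a, b, d}" "w \<in> {x, a, b, d}" for v w
    using plane_embedding_inj[OF G] V that by (intro inj_on_eq_iff[of p "verts G"]) auto
  have E': "{x, a} \<noteq> {x, d}" "{x, b} \<noteq> {x, a}" "{x, b} \<noteq> {x, d}"
    using distinct by (auto simp: doubleton_eq_iff)
  obtain ga where ga: "arc ga" "pathstart ga = p x" "pathfinish ga = p a" "path_image ga = path_image (c {x, a})"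
    using oriented_edge[OF G E(1)] .
  obtain gd where gd: "arc gd" "pathstart gd = p x" "pathfinish gd = p d" "path_image gd = path_image (c {x, d})"
    using oriented_edge[OF G E(3)] .
  obtain \<beta> where \<beta>: "arc \<beta>" "pathstart \<beta> = p x" "pathfinish \<beta> = p b" "path_image \<beta> = path_image (c {x, b})"
    using oriented_edge[OF G E(2)] .
  define \<alpha> where "\<alpha> = reversepath ga +++ gd"
  have "path_image (c {x, a}) \<inter> path_image (c {x, d}) \<subseteq> p ` ({x, a} \<inter> {x, d})"
    using plane_embedding_edgeD(4)[OF G E(1) E(3) E'(1)] .
  also have "{x, a} \<inter> {x, d} = {x}" using distinct by auto
  finally have \<alpha>: "arc \<alpha>"
    using ga gd by (auto simp: \<alpha>_def intro!: arc_join arc_reversepath)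
  have \<alpha>_ends: "pathstart \<alpha> = p a" "pathfinish \<alpha> = p d"
    using ga gd by (auto simp: \<alpha>_def)
  have \<alpha>_image: "path_image \<alpha> = path_image (c {x, a}) \<union> path_image (c {x, d})"
    using ga gd by (simp add: \<alpha>_def path_image_join)
  have "path_image (c {x, b}) \<inter> path_image (c {x, a}) \<subseteq> p ` ({x, b} \<inter> {x, a})"
    "path_image (c {x, b}) \<inter> path_image (c {x, d}) \<subseteq> p ` ({x, b} \<inter> {x, d})"
    using plane_embedding_edgeD(4)[OF G E(2)] E E' by auto
  moreover have "{x, b} \<inter> {x, a} = {x}" "{x, b} \<inter> {x, d} = {x}" using distinct by auto
  ultimately have "path_image \<beta> \<inter> path_image \<alpha> \<subseteq> {p x}"
    unfolding \<alpha>_image \<beta>(4) by auto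
  moreover have "p x \<in> path_image \<beta>" "p x \<in> path_image \<alpha>"
    using \<beta>(2) gd(2,4) pathstart_in_path_image by (metis, metis \<alpha>_image UnI2)
  ultimately have meet: "path_image \<beta> \<inter> path_image \<alpha> = {pathstart \<beta>}" using \<beta>(2) by auto
  have "pathstart \<beta> \<noteq> pathstart \<alpha>" "pathstart \<beta> \<noteq> pathfinish \<alpha>"
    using p distinct by (auto simp: \<alpha>_ends \<beta>)
  then obtain \<Psi> :: "complex \<Rightarrow> complex" and \<gamma> where \<Psi>: "inj \<Psi>" "continuous_on (- path_image \<alpha> \<union> {p a, p d}) \<Psi>"
      "continuous_on (path_image \<alpha>) \<Psi>" "continuous_on (path_image \<beta>) \<Psi>"
    and \<gamma>: "arc \<gamma>" "pathstart \<gamma> = \<Psi> (p a)" "pathfinish \<gamma> = \<Psi> (p d)"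
      "path_image \<gamma> \<inter> range \<Psi> \<subseteq> {\<Psi> (p a), \<Psi> (p d)}"
    using slit_opening[OF \<alpha> \<beta>(1) _ _ meet] unfolding \<alpha>_ends by auto
  have cont: "continuous_on (path_image (c e)) \<Psi>" if e: "e \<in> edges G" for e
  proof (cases "x \<in> e")
    case True
    then consider "e = {x, a}" | "e = {x, b}" | "e = {x, d}" using star e by blast
    then show ?thesis
      using \<Psi>(3,4) unfolding \<alpha>_image \<beta>(4) by cases (auto elim: continuous_on_subset)
  next
    case False
    then have ne: "e \<noteq> {x, a}" "e \<noteq> {x, d}" by auto
    have "path_image (c e) \<inter> path_image \<alpha> \<subseteq> p ` (e \<inter> {x, a}) \<union> p ` (e \<inter> {x, d})"
      using plane_embedding_edgeD(4)[OF G e E(1) ne(1)] plane_embedding_edgeD(4)[OF G e E(3) ne(2)]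
      unfolding \<alpha>_image by blast
    also have "\<dots> \<subseteq> {p a, p d}" using False by auto
    finally show ?thesis by (intro continuous_on_subset[OF \<Psi>(2)]) auto
  qed
  let ?c = "\<lambda>e. \<Psi> \<circ> c e"
  have G': "plane_embedding G (\<Psi> \<circ> p) ?c"
    using \<Psi>(1) cont by (intro plane_embedding_transport G) (auto intro: inj_on_subset)
  have "drawing G (\<Psi> \<circ> p) ?c \<subseteq> range \<Psi>"
    by (auto simp: drawing_def path_image_def)
  then have "path_image \<gamma> \<inter> drawing G (\<Psi> \<circ> p) ?c \<subseteq> {(\<Psi> \<circ> p) a, (\<Psi> \<circ> p) d}"
    using \<gamma>(4) by auto
  then show ?thesis
    unfolding planar_def
    using plane_embedding_insert_edge[OF G' V(2,4) \<gamma>(1) _ _ _ simple new] \<gamma>(2,3) by auto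
qed

section \<open>Joining two edges of a face\<close>

lemma simple_graph_subdivide:
  assumes "simple_graph G" "{a, b} \<in> edges G" "m \<notin> verts G"
  shows "simple_graph \<lparr>verts = insert m (verts G), edges = edges G - {{a, b}} \<union> {{a, m}, {m, b}}\<rparr>"
proof -
  have "a \<in> verts G" "b \<in> verts G" using assms by (auto simp: simple_graph_def)
  then show ?thesis using assms by (auto simp: simple_graph_def card_insert_if)
qed

text \<open>The inner point \<open>q\<close> cuts the arc into two. The last two conclusions allow a
  second subdivision on another edge, and the later insertion of an arc found in a face of the
  original drawing.\<close>

lemma plane_embedding_subdivide:
  assumes G: "plane_embedding G p c" and simple: "simple_graph G"
    and ab: "{a, b} \<in> edges G" and m: "m \<notin> verts G"
    and q: "q \<in> path_image (c {a, b})" "q \<noteq> p a" "q \<noteq> p b"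
  obtains c' where
    "plane_embedding \<lparr>verts = insert m (verts G), edges = edges G - {{a, b}} \<union> {{a, m}, {m, b}}\<rparr> (p(m := q)) c'"
    "drawing \<lparr>verts = insert m (verts G), edges = edges G - {{a, b}} \<union> {{a, m}, {m, b}}\<rparr> (p(m := q)) c'
       = drawing G p c"
    "\<And>e. e \<in> edges G \<Longrightarrow> e \<noteq> {a, b} \<Longrightarrow> c' e = c e"
proof -
  have V: "e \<subseteq> verts G" if "e \<in> edges G" for e using that simple by (auto simp: simple_graph_def)
  have ab_ne: "a \<noteq> b" using simple ab by (auto simp: simple_graph_def)
  have ab_V: "a \<in> verts G" "b \<in> verts G" "m \<noteq> a" "m \<noteq> b" using V[OF ab] m by auto
  obtain g where g: "arc g" "pathstart g = p a" "pathfinish g = p b" "path_image g = path_image (c {a, b})"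
    using oriented_edge[OF G ab] .
  obtain t where t: "t \<in> {0..1}" "q = g t" using q(1) g(4)[symmetric] by (auto simp: path_image_def)
  have "t \<noteq> 0" "t \<noteq> 1" using t q g by (auto simp: pathstart_def pathfinish_def)
  then have t01: "0 < t" "t < 1" using t by auto
  have g01: "g 0 = p a" "g 1 = p b" using g by (simp_all add: pathstart_def pathfinish_def)
  define P Q where "P = g ` {0..t}" and "Q = g ` {t..1}"
  define c' where "c' = c({a, m} := subpath 0 t g, {m, b} := subpath t 1 g)"
  let ?p = "p(m := q)"
  let ?E = "edges G - {{a, b}} \<union> {{a, m}, {m, b}}"
  have inj: "inj_on g {0..1}" using g by (simp add: arc_def)
  have "{0..1} = {0..t} \<union> {t..1::real}" "{0..t} \<inter> {t..1} = {t}" using t01 by auto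
  then have "P \<union> Q = path_image g" and PQ2: "P \<inter> Q = {q}"
    using inj_on_image_Int[OF inj, of "{0..t}" "{t..1}"] t01
    unfolding P_def Q_def path_image_def t(2) by (simp_all flip: image_Un)
  then have PQ: "P \<union> Q = path_image (c {a, b})" "P \<inter> Q = {q}" using g(4) by simp_all
  have ends: "p a \<in> P" "p b \<in> Q"
    using t01 unfolding g(2,3)[symmetric] P_def Q_def pathstart_def pathfinish_def by (auto intro: imageI)
  have ends': "p a \<notin> Q" "p b \<notin> P"
  proof -
    have "z = q" if "z \<in> P" "z \<in> Q" for z
    proof -
      have "z \<in> P \<inter> Q" using that by blast
      then show ?thesis unfolding PQ(2) by simp
    qed
    then show "p a \<notin> Q" "p b \<notin> P" using ends q(2,3) by metis+
  qed
  have new: "{a, m} \<notin> edges G" "{m, b} \<notin> edges G" "{a, m} \<noteq> {m, b}"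
    using V m ab_ne by (auto simp: doubleton_eq_iff)
  have c'm: "c' {a, m} = subpath 0 t g" "c' {m, b} = subpath t 1 g"
    using new(3) by (simp_all add: c'_def)
  have c'1: "path_image (c' {a, m}) = P" "path_image (c' {m, b}) = Q"
    using t01 unfolding c'm by (simp_all add: P_def Q_def path_image_subpath)
  have c'_old: "c' e = c e" if "e \<in> edges G" for e using new that by (auto simp: c'_def)
  have p_old: "?p ` e = p ` e" if "e \<subseteq> verts G" for e using m that by (intro image_cong) auto
  \<comment> \<open>An embedding keeps all vertices except \<open>a\<close> and \<open>b\<close> off
    this curve, and \<open>q\<close> differs from their positions.\<close>
  have q_V: "q \<noteq> p w" if "w \<in> verts G" for w
    using plane_embedding_edgeD(3)[OF G ab, of w] q that by auto
  have sub: "P \<inter> path_image (c e) \<subseteq> p ` (e \<inter> {a})" "Q \<inter> path_image (c e) \<subseteq> p ` (e \<inter> {b})"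
    if e: "e \<in> edges G" "e \<noteq> {a, b}" for e
  proof -
    have "path_image (c {a, b}) \<inter> path_image (c e) \<subseteq> p ` ({a, b} \<inter> e)"
      using plane_embedding_edgeD(4)[OF G ab e(1)] e(2) by auto
    then show "P \<inter> path_image (c e) \<subseteq> p ` (e \<inter> {a})" "Q \<inter> path_image (c e) \<subseteq> p ` (e \<inter> {b})"
      using PQ(1) ends' by blast+
  qed
  \<comment> \<open>The crossing clause for one pair of edges, named so that symmetry can be used in
    the case analysis.\<close>
  define ok where "ok = (\<lambda>e e'. path_image (c' e) \<inter> path_image (c' e') \<subseteq> ?p ` (e \<inter> e'))"
  have ok_sym: "ok e e' \<longleftrightarrow> ok e' e" for e e' by (simp add: ok_def Int_commute)
  have ok_old: "ok e e'" if "e \<in> edges G" "e' \<in> edges G" "e \<noteq> e'" for e e'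
  proof -
    have "e \<inter> e' \<subseteq> verts G" using V[OF that(1)] by blast
    from p_old[OF this] show ?thesis
      using plane_embedding_edgeD(4)[OF G that] unfolding ok_def c'_old[OF that(1)] c'_old[OF that(2)] by (simp only:)
  qed
  have ok_new: "ok e {a, m}" "ok e {m, b}" if "e \<in> edges G" "e \<noteq> {a, b}" for e
  proof -
    have "p ` (e \<inter> {v}) \<subseteq> ?p ` (e \<inter> {v, m})" for v
    proof -
      have "?p ` (e \<inter> {v}) = p ` (e \<inter> {v})" using V[OF that(1)] by (intro p_old) blast
      then show ?thesis by (metis Int_mono image_mono order_refl insert_mono empty_subsetI)
    qed
    from order_trans[OF sub(1)[OF that] this] order_trans[OF sub(2)[OF that] this]
    show "ok e {a, m}" "ok e {m, b}"
      unfolding ok_def c'_old[OF that(1)] c'1 unfolding insert_commute[of m b] Int_commute[of "path_image (c e)"]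
      by this+
  qed
  have ok_am: "ok {a, m} {m, b}"
    using PQ(2) by (auto simp: ok_def c'1)
  have ok: "ok e e'" if ee: "e \<in> ?E" "e' \<in> ?E" "e \<noteq> e'" for e e'
  proof -
    consider "e \<in> edges G" "e' \<in> edges G" "e \<noteq> {a, b}" "e' \<noteq> {a, b}"
      | "e \<in> edges G" "e \<noteq> {a, b}" "e' \<in> {{a, m}, {m, b}}"
      | "e' \<in> edges G" "e' \<noteq> {a, b}" "e \<in> {{a, m}, {m, b}}"
      | "e \<in> {{a, m}, {m, b}}" "e' \<in> {{a, m}, {m, b}}"
      using ee(1,2) by (cases "e \<in> {{a, m}, {m, b}}"; cases "e' \<in> {{a, m}, {m, b}}") simp_all
    then show ?thesis
    proof cases
      case 1 then show ?thesis using ok_old ee(3) by simp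
    next
      case 2 then show ?thesis using ok_new by auto
    next
      case 3 then show ?thesis using ok_new ok_sym[of e e'] by auto
    next
      case 4 then show ?thesis using ok_am ok_sym[of e e'] ee(3) by auto
    qed
  qed
  have emb: "plane_embedding \<lparr>verts = insert m (verts G), edges = ?E\<rparr> ?p c'"
    unfolding plane_embedding_def sgraph.simps
  proof (intro conjI ballI impI)
    show "inj_on ?p (insert m (verts G))"
      using plane_embedding_inj[OF G] q_V m by (auto simp: inj_on_def)
    fix e assume e: "e \<in> ?E"
    consider "e \<in> edges G" "e \<noteq> {a, b}" | "e = {a, m}" | "e = {m, b}" using e by blast
    note cs = this
    show "arc (c' e)"
      using cs
    proof cases
      case 1 then show ?thesis using c'_old plane_embedding_edgeD(1)[OF G] by auto
    next
      case 2 then show ?thesis using t01 g(1) unfolding 2 c'm by (simp add: arc_subpath_arc)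
    next
      case 3 then show ?thesis using t01 g(1) unfolding 3 c'm by (simp add: arc_subpath_arc)
    qed
    show "{pathstart (c' e), pathfinish (c' e)} = ?p ` e"
      using cs
    proof cases
      case 1 then show ?thesis using c'_old plane_embedding_edgeD(2)[OF G] V[of e] p_old[of e] by auto
    next
      case 2 then show ?thesis using g01 t(2) ab_V unfolding 2 c'm by simp
    next
      case 3 then show ?thesis using g01 t(2) ab_V unfolding 3 c'm by (simp add: insert_commute)
    qed
    show "w \<in> e" if w: "w \<in> insert m (verts G)" "?p w \<in> path_image (c' e)" for w
      using cs
    proof cases
      case 1
      then have "q \<notin> path_image (c e)"
        using plane_embedding_edgeD(4)[OF G 1(1) ab 1(2)] q V[OF 1(1)] q_V by blast
      then show ?thesis using c'_old 1 plane_embedding_edgeD(3)[OF G 1(1), of w] w by (auto split: if_splits)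
    next
      case 2
      have "w = a" if "w \<noteq> m"
        using that w plane_embedding_edgeD(3)[OF G ab, of w] PQ(1) ends' unfolding 2 c'1 by auto
      then show ?thesis using 2 by auto
    next
      case 3
      have "w = b" if "w \<noteq> m"
        using that w plane_embedding_edgeD(3)[OF G ab, of w] PQ(1) ends' unfolding 3 c'1 by auto
      then show ?thesis using 3 by auto
    qed
    fix e' assume "e' \<in> ?E" "e \<noteq> e'"
    then show "path_image (c' e) \<inter> path_image (c' e') \<subseteq> ?p ` (e \<inter> e')"
      using ok[OF e] by (simp add: ok_def)
  qed
  have "(\<Union>e\<in>?E. path_image (c' e)) = (\<Union>e\<in>edges G - {{a, b}}. path_image (c e)) \<union> P \<union> Q"
    using c'_old c'1 by auto
  also have "\<dots> = (\<Union>e\<in>edges G. path_image (c e))" using PQ(1) ab by auto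
  finally have "drawing \<lparr>verts = insert m (verts G), edges = ?E\<rparr> ?p c' = drawing G p c"
    using p_old[of "verts G"] q(1) ab by (auto simp: drawing_def)
  with emb show ?thesis using that c'_old by blast
qed

text \<open>A finite union of compact sets. Subfamilies are allowed because the result serves both
  for the whole drawing and for the drawing without the interior of one edge.\<close>

lemma closed_arcs_union:
  assumes "plane_embedding G p c" "simple_graph G" "E \<subseteq> edges G" "V \<subseteq> verts G"
  shows "closed (p ` V \<union> (\<Union>e\<in>E. path_image (c e)))"
proof -
  have "finite (edges G)"
    using assms(2) by (auto simp: simple_graph_def intro!: finite_subset[of "edges G" "Pow (verts G)"])
  moreover have "closed (path_image (c e))" if "e \<in> E" for e
    using that plane_embedding_edgeD(1)[OF assms(1)] assms(3) by (auto intro!: closed_path_image arc_imp_path)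
  ultimately show ?thesis
    using assms by (intro closed_Un closed_UN finite_imp_closed)
      (auto simp: simple_graph_def intro: finite_subset)
qed

text \<open>Points accessible from an open connected set are dense in its frontier. So each of the
  two edges has an accessible inner point, and an arc through \<open>F\<close> joins these points,
  which become \<open>m\<close> and \<open>m'\<close>.\<close>

lemma planar_subdivide_and_join:
  assumes G: "plane_embedding G p c" and simple: "simple_graph G"
    and ab: "{a, b} \<in> edges G" and ab': "{a', b'} \<in> edges G" and ne: "{a, b} \<noteq> {a', b'}"
    and F: "F \<in> faces G p c"
    and bd: "path_image (c {a, b}) \<subseteq> frontier F" "path_image (c {a', b'}) \<subseteq> frontier F"
    and m: "m \<notin> verts G" "m' \<notin> verts G" "m \<noteq> m'"
  shows "planar \<lparr>verts = verts G \<union> {m, m'}, edges = edges G - {{a, b}, {a', b'}}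
           \<union> {{a, m}, {m, b}, {a', m'}, {m', b'}, {m, m'}}\<rparr>"
proof -
  let ?D = "drawing G p c"
  have cl: "closed ?D" unfolding drawing_def using G simple by (rule closed_arcs_union) auto
  have F: "open F" "connected F" "F \<subseteq> - ?D" "frontier F \<subseteq> ?D"
    using F cl open_components[of "- ?D" F] in_components_connected[of F "- ?D"]
      in_components_subset[of F "- ?D"] frontier_of_components_closed_complement[of ?D F]
    by (auto simp: faces_def)
  \<comment> \<open>\<open>R e\<close> is the drawing without the interior of \<open>e\<close>, so
    \<open>U e\<close> is a relatively open piece of the frontier that lies inside the edge.\<close>
  define R where "R = (\<lambda>e. p ` verts G \<union> (\<Union>e'\<in>edges G - {e}. path_image (c e')))"
  have R: "closed (R e)" for e
    unfolding R_def using G simple by (rule closed_arcs_union) auto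
  define U where "U = (\<lambda>e. frontier F - R e)"
  have open_U: "openin (top_of_set (frontier F)) (U e)" for e
    using R[of e] by (auto simp: U_def Diff_eq intro: openin_open_Int)
  have U_sub: "U e \<subseteq> path_image (c e)" for e
    using F(4) by (auto simp: U_def R_def drawing_def)
  have U_ne: "U e \<noteq> {}" if e: "e \<in> edges G" "path_image (c e) \<subseteq> frontier F" for e
  proof -
    \<comment> \<open>The witness is the midpoint of the parametrisation: an inner point of the
      curve lies on no other edge and is not the position of a vertex.\<close>
    have "c e (1/2) \<in> path_image (c e)" by (auto simp: path_image_def)
    moreover have "inj_on (c e) {0..1}" using plane_embedding_edgeD(1)[OF G e(1)] by (simp add: arc_def)
    then have "c e (1/2) \<notin> {pathstart (c e), pathfinish (c e)}"
      by (auto simp: pathstart_def pathfinish_def dest: inj_onD)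
    then have "c e (1/2) \<notin> p ` e" using plane_embedding_edgeD(2)[OF G e(1)] by simp
    moreover have "path_image (c e) \<inter> R e \<subseteq> p ` e"
      using plane_embedding_edgeD(3,4)[OF G e(1)] unfolding R_def by blast
    ultimately show ?thesis using e(2) unfolding U_def by blast
  qed
  have U_disj: "U {a, b} \<noteq> U {a', b'}"
  proof
    assume eq: "U {a, b} = U {a', b'}"
    have "U {a, b} \<subseteq> R {a', b'}" using U_sub[of "{a, b}"] ab ne by (auto simp: R_def)
    then show False using eq U_ne[OF ab bd(1)] by (auto simp: U_def)
  qed
  obtain \<gamma> where \<gamma>: "arc \<gamma>" "pathstart \<gamma> \<in> U {a, b}" "pathfinish \<gamma> \<in> U {a', b'}" "\<gamma> ` {0<..<1} \<subseteq> F"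
    using dense_accessible_frontier_point_pairs[OF F(1,2) open_U open_U U_ne[OF ab bd(1)] U_ne[OF ab' bd(2)] U_disj] .
  define q q' where "q = pathstart \<gamma>" and "q' = pathfinish \<gamma>"
  have V: "a \<in> verts G" "b \<in> verts G" "a' \<in> verts G" "b' \<in> verts G"
    using simple ab ab' by (auto simp: simple_graph_def)
  have "U e \<inter> p ` verts G = {}" for e by (auto simp: U_def R_def)
  then have q: "q \<in> path_image (c {a, b})" "q \<noteq> p a" "q \<noteq> p b"
    and q': "q' \<in> path_image (c {a', b'})" "q' \<noteq> p a'" "q' \<noteq> p b'"
    using \<gamma>(2,3) U_sub V by (auto simp: q_def q'_def)
  let ?H = "\<lparr>verts = insert m (verts G), edges = edges G - {{a, b}} \<union> {{a, m}, {m, b}}\<rparr>"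
  obtain c1 where c1: "plane_embedding ?H (p(m := q)) c1" "drawing ?H (p(m := q)) c1 = ?D"
      "\<And>e. e \<in> edges G \<Longrightarrow> e \<noteq> {a, b} \<Longrightarrow> c1 e = c e"
    using plane_embedding_subdivide[OF G simple ab m(1) q] by metis
  have H: "simple_graph ?H" using simple_graph_subdivide[OF simple ab m(1)] .
  have ab'_H: "{a', b'} \<in> edges ?H" using ab' ne by auto
  have m': "m' \<notin> verts ?H" using m by auto
  have q'_H: "q' \<in> path_image (c1 {a', b'})" "q' \<noteq> (p(m := q)) a'" "q' \<noteq> (p(m := q)) b'"
    using q' c1(3)[OF ab'] ne V m by auto
  let ?K = "\<lparr>verts = insert m' (verts ?H), edges = edges ?H - {{a', b'}} \<union> {{a', m'}, {m', b'}}\<rparr>"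
  let ?p = "p(m := q, m' := q')"
  \<comment> \<open>Neither subdivision alters the drawing as a point set, so the arc through
    \<open>F\<close> still meets it only in its ends.\<close>
  obtain c2 where c2: "plane_embedding ?K ?p c2" "drawing ?K ?p c2 = ?D"
    using plane_embedding_subdivide[OF c1(1) H ab'_H m' q'_H] c1(2) by metis
  have K: "simple_graph ?K" using simple_graph_subdivide[OF H ab'_H m'] .
  have "path_image \<gamma> = insert q (insert q' (\<gamma> ` {0<..<1}))"
    using simple_path_endless[OF arc_imp_simple_path[OF \<gamma>(1)]] pathstart_in_path_image[of \<gamma>] pathfinish_in_path_image[of \<gamma>]
    by (auto simp: q_def q'_def)
  then have "path_image \<gamma> \<inter> drawing ?K ?p c2 \<subseteq> {?p m, ?p m'}"
    using \<gamma>(4) F(3) m(3) unfolding c2(2) by auto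
  moreover have "{m, m'} \<notin> edges ?K"
    using simple m V by (auto simp: simple_graph_def doubleton_eq_iff)
  ultimately have "plane_embedding \<lparr>verts = verts ?K, edges = insert {m, m'} (edges ?K)\<rparr> ?p (c2({m, m'} := \<gamma>))"
    using m(3) by (intro plane_embedding_insert_edge c2(1) \<gamma>(1) K) (auto simp: q_def q'_def)
  then have "planar \<lparr>verts = verts ?K, edges = insert {m, m'} (edges ?K)\<rparr>"
    by (auto simp: planar_def)
  then show ?thesis
    using m V by (elim planar_subgraph) (auto simp: doubleton_eq_iff)
qed

section \<open>Gluing at vertices of degree three\<close>

text \<open>In \<open>spokes G p c A r H B\<close> the arcs \<open>r a\<close> are the stubs of severed edges: they lead
  from the vertices \<open>a \<in> A\<close> of the drawing, which lies in \<open>H\<close>, to the set \<open>B\<close> outside \<open>H\<close>.\<close>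

definition spokes where
  "spokes G p c A r H B \<longleftrightarrow> plane_embedding G p c \<and> drawing G p c \<subseteq> H \<and>
     (\<forall>a\<in>A. arc (r a) \<and> pathstart (r a) = p a \<and> pathfinish (r a) \<in> B \<and>
        path_image (r a) - {pathfinish (r a)} \<subseteq> H \<and> path_image (r a) \<inter> drawing G p c \<subseteq> {p a}) \<and>
     (\<forall>a\<in>A. \<forall>a'\<in>A. a \<noteq> a' \<longrightarrow> path_image (r a) \<inter> path_image (r a') = {})"

lemma simple_graph_edgeD:
  assumes "simple_graph G" "{x, y} \<in> edges G"
  shows "x \<in> verts G" "y \<in> verts G" "x \<noteq> y"
proof -
  have *: "{x, y} \<subseteq> verts G" "card {x, y} = 2"
  proof -
    have "\<forall>e\<in>edges G. e \<subseteq> verts G \<and> card e = 2" using assms(1) by (simp add: simple_graph_def)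
    from bspec[OF this assms(2)] show "{x, y} \<subseteq> verts G" "card {x, y} = 2" by auto
  qed
  show "x \<in> verts G" "y \<in> verts G" using *(1) by simp_all
  show "x \<noteq> y" using *(2) by (cases "x = y") simp_all
qed

lemma spokesD:
  assumes "spokes G p c A r H B"
  shows "plane_embedding G p c" "drawing G p c \<subseteq> H"
    "a \<in> A \<Longrightarrow> arc (r a)" "a \<in> A \<Longrightarrow> pathstart (r a) = p a" "a \<in> A \<Longrightarrow> pathfinish (r a) \<in> B"
    "a \<in> A \<Longrightarrow> path_image (r a) - {pathfinish (r a)} \<subseteq> H"
    "a \<in> A \<Longrightarrow> path_image (r a) \<inter> drawing G p c \<subseteq> {p a}"
    "a \<in> A \<Longrightarrow> a' \<in> A \<Longrightarrow> a \<noteq> a' \<Longrightarrow> path_image (r a) \<inter> path_image (r a') = {}"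
  using assms unfolding spokes_def by simp_all

text \<open>The stubs leave \<open>H\<close> only at their last points, so everything drawn lies in
  \<open>H\<close> together with these points. Asking for continuity and injectivity just there
  admits Moebius maps with a pole on the boundary of \<open>H\<close>.\<close>

lemma spokes_transport:
  assumes sp: "spokes G p c A r H B"
    and A: "A \<subseteq> verts G"
    and inj: "inj_on f (H \<union> (\<lambda>a. pathfinish (r a)) ` A)"
    and cont: "continuous_on (H \<union> (\<lambda>a. pathfinish (r a)) ` A) f"
    and H: "f ` H \<subseteq> H'" and B: "\<And>a. a \<in> A \<Longrightarrow> f (pathfinish (r a)) \<in> B'"
  shows "spokes G (f \<circ> p) (\<lambda>e. f \<circ> c e) A (\<lambda>a. f \<circ> r a) H' B'"
proof -
  let ?W = "H \<union> (\<lambda>a. pathfinish (r a)) ` A"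
  note S = spokesD[OF sp]
  have D: "drawing G p c \<subseteq> ?W" using S(2) by blast
  have R: "path_image (r a) \<subseteq> ?W" if "a \<in> A" for a
  proof -
    have "path_image (r a) - {pathfinish (r a)} \<subseteq> H" using S(6)[OF that] .
    then show ?thesis using that by blast
  qed
  have D': "drawing G (f \<circ> p) (\<lambda>e. f \<circ> c e) = f ` drawing G p c"
    unfolding drawing_def image_Un image_UN path_image_compose image_comp by simp
  have pA: "p a \<in> drawing G p c" if "a \<in> A" for a using that A by (auto simp: drawing_def)
  show ?thesis
    unfolding spokes_def D'
  proof (intro conjI ballI impI)
    show "plane_embedding G (f \<circ> p) (\<lambda>e. f \<circ> c e)"
    proof (rule plane_embedding_transport)
      show "plane_embedding G p c" using S(1) .
      show "inj_on f (drawing G p c)" using inj D by (rule inj_on_subset)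
      show "continuous_on (path_image (c e)) f" if "e \<in> edges G" for e
        using D that by (intro continuous_on_subset[OF cont]) (auto simp: drawing_def)
    qed
    show "f ` drawing G p c \<subseteq> H'" using S(2) H by blast
    fix a assume a: "a \<in> A"
    have arc: "arc (r a)" using S(3)[OF a] .
    have "continuous_on (path_image (r a)) f" "inj_on f (path_image (r a))"
      using R[OF a] by (auto intro: continuous_on_subset[OF cont] inj_on_subset[OF inj])
    then show "arc (f \<circ> r a)"
      using arc by (auto simp: arc_def path_image_def intro!: path_continuous_image comp_inj_on)
    show "pathstart (f \<circ> r a) = (f \<circ> p) a" using S(4)[OF a] by (simp add: pathstart_compose)
    show "pathfinish (f \<circ> r a) \<in> B'" using B[OF a] by (simp add: pathfinish_compose)
    have "path_image (r a) - {pathfinish (r a)} \<subseteq> H" using S(6)[OF a] .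
    then show "path_image (f \<circ> r a) - {pathfinish (f \<circ> r a)} \<subseteq> H'"
      using H unfolding path_image_compose pathfinish_compose by blast
    have "f ` path_image (r a) \<inter> f ` drawing G p c = f ` (path_image (r a) \<inter> drawing G p c)"
      using inj_on_image_Int[OF inj R[OF a] D] by simp
    also have "\<dots> \<subseteq> f ` {p a}" using S(7)[OF a] by (rule image_mono)
    finally show "path_image (f \<circ> r a) \<inter> f ` drawing G p c \<subseteq> {(f \<circ> p) a}"
      by (simp add: path_image_compose)
    fix a' assume a': "a' \<in> A" "a \<noteq> a'"
    have "path_image (r a) \<inter> path_image (r a') = {}" using S(8)[OF a a'] .
    then show "path_image (f \<circ> r a) \<inter> path_image (f \<circ> r a') = {}"
      using inj_on_image_Int[OF inj R[OF a] R[OF a'(1)]] by (simp add: path_image_compose)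
  qed
qed

text \<open>What remains after the removal of \<open>w\<close> is drawn on a closed set missing
  \<open>p w\<close>, so a small disc around \<open>p w\<close> meets only the edges at
  \<open>w\<close>. Each of these, followed from \<open>a\<close> inwards, is cut where it first
  reaches the circle.\<close>

lemma spokes_outside_disc:
  assumes G: "plane_embedding G p c" and simple: "simple_graph G"
    and w: "w \<in> verts G" and star: "{e \<in> edges G. w \<in> e} = (\<lambda>a. {w, a}) ` A"
  obtains r R where "0 < R"
    "spokes \<lparr>verts = verts G - {w}, edges = {e \<in> edges G. w \<notin> e}\<rparr> p c A r
       (- cball (p w) R) (sphere (p w) R)"
proof -
  let ?G = "\<lparr>verts = verts G - {w}, edges = {e \<in> edges G. w \<notin> e}\<rparr>"
  let ?D = "drawing ?G p c"
  have E: "{w, a} \<in> edges G" if "a \<in> A" for a using star that by blast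
  have V: "a \<in> verts G" "a \<noteq> w" if "a \<in> A" for a
    using E[OF that] simple by (auto simp: simple_graph_def)
  have G': "plane_embedding ?G p c" using plane_embedding_subgraph[OF G] by auto
  have "closed ?D" unfolding drawing_def using G simple by (rule closed_arcs_union) auto
  moreover have "p w \<notin> ?D"
  proof
    assume "p w \<in> ?D"
    then consider v where "v \<in> verts G" "v \<noteq> w" "p w = p v" | e where "e \<in> edges G" "w \<notin> e" "p w \<in> path_image (c e)"
      by (auto simp: drawing_def)
    then show False
      using plane_embedding_inj[OF G] plane_embedding_edgeD(3)[OF G] w by cases (auto dest: inj_onD)
  qed
  ultimately obtain R' where R': "R' > 0" "ball (p w) R' \<subseteq> - ?D"
    by (meson Compl_iff open_Compl open_contains_ball)
  \<comment> \<open>Halving the radius makes the closed disc fit into the open ball.\<close>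
  define R where "R = R' / 2"
  have R: "R > 0" using R' by (simp add: R_def)
  have "cball (p w) R \<subseteq> ball (p w) R'" using R' by (auto simp: R_def)
  then have RD: "?D \<subseteq> - cball (p w) R" using R'(2) by blast
  have "\<exists>r. arc r \<and> pathstart r = p a \<and> pathfinish r \<in> sphere (p w) R \<and>
      path_image r - {pathfinish r} \<subseteq> - cball (p w) R \<and> path_image r \<subseteq> path_image (c {w, a}) - {p w}"
    if a: "a \<in> A" for a
  proof -
    have "{a, w} \<in> edges G" using E[OF a] by (simp add: insert_commute)
    then obtain g where g: "arc g" "pathstart g = p a" "pathfinish g = p w" "path_image g = path_image (c {a, w})"
      using oriented_edge[OF G] by blast
    have pa: "p a \<in> - cball (p w) R" using RD V[OF a] by (auto simp: drawing_def)
    have g01: "g 0 = p a" "g 1 = p w" using g by (simp_all add: pathstart_def pathfinish_def)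
    have "pathstart g \<in> closure (- cball (p w) R)" using pa g(2) closure_subset by fastforce
    moreover have "pathfinish g \<notin> - cball (p w) R" using g(3) R by simp
    ultimately obtain u where u: "0 \<le> u" "u \<le> 1" "g u \<in> frontier (- cball (p w) R)"
        "path_image (subpath 0 u g) - {g u} \<subseteq> interior (- cball (p w) R)"
      using subpath_to_frontier[OF arc_imp_path[OF g(1)]] by blast
    have gu: "g u \<in> sphere (p w) R" using u(3) R by (simp add: frontier_complement)
    then have u0: "u \<noteq> 0" using pa g01 by auto
    let ?r = "subpath 0 u g"
    have fin: "pathfinish ?r = g u" by simp
    have out: "path_image ?r - {g u} \<subseteq> - cball (p w) R"
      using u(4) interior_subset by blast
    have "p w \<notin> path_image ?r"
    proof
      assume "p w \<in> path_image ?r"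
      moreover have "p w \<noteq> g u" using gu R by auto
      ultimately show False using out R by auto
    qed
    moreover have "path_image ?r \<subseteq> path_image (c {w, a})"
      using path_image_subpath_subset[of 0 u g] u g(4) by (simp add: insert_commute)
    ultimately show ?thesis
      using g(1) g01 u(1,2) u0 gu out by (intro exI[of _ ?r]) (auto simp: arc_subpath_arc)
  qed
  then obtain r where r: "\<And>a. a \<in> A \<Longrightarrow> arc (r a) \<and> pathstart (r a) = p a \<and> pathfinish (r a) \<in> sphere (p w) R \<and>
      path_image (r a) - {pathfinish (r a)} \<subseteq> - cball (p w) R \<and> path_image (r a) \<subseteq> path_image (c {w, a}) - {p w}"
    by metis
  have "path_image (r a) \<inter> ?D \<subseteq> {p a}" if a: "a \<in> A" for a
  proof
    fix z assume z: "z \<in> path_image (r a) \<inter> ?D"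
    then have za: "z \<in> path_image (c {w, a})" "z \<noteq> p w" using r[OF a] by auto
    from z consider v where "v \<in> verts G" "v \<noteq> w" "z = p v" | e where "e \<in> edges G" "w \<notin> e" "z \<in> path_image (c e)"
      by (auto simp: drawing_def)
    then show "z \<in> {p a}"
    proof cases
      case 1
      then show ?thesis using plane_embedding_edgeD(3)[OF G E[OF a], of v] za by auto
    next
      case 2
      then have "{w, a} \<noteq> e" by auto
      then have "z \<in> p ` ({w, a} \<inter> e)" using plane_embedding_edgeD(4)[OF G E[OF a] 2(1)] za 2(3) by blast
      then show ?thesis using 2(2) by auto
    qed
  qed
  moreover have "path_image (r a) \<inter> path_image (r a') = {}" if a: "a \<in> A" "a' \<in> A" "a \<noteq> a'" for a a'
  proof -
    have "{w, a} \<noteq> {w, a'}" using a by (auto simp: doubleton_eq_iff)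
    then have "path_image (c {w, a}) \<inter> path_image (c {w, a'}) \<subseteq> p ` ({w, a} \<inter> {w, a'})"
      using plane_embedding_edgeD(4)[OF G E[OF a(1)] E[OF a(2)]] by blast
    also have "{w, a} \<inter> {w, a'} = {w}" using a by auto
    finally have "path_image (c {w, a}) \<inter> path_image (c {w, a'}) \<subseteq> {p w}" by simp
    moreover have "path_image (r a) \<subseteq> path_image (c {w, a}) - {p w}" using r[OF a(1)] by simp
    moreover have "path_image (r a') \<subseteq> path_image (c {w, a'}) - {p w}" using r[OF a(2)] by simp
    ultimately show ?thesis by blast
  qed
  ultimately have "spokes ?G p c A r (- cball (p w) R) (sphere (p w) R)"
    unfolding spokes_def using G' RD r by simp
  then show ?thesis using that R by blast
qed

section \<open>Moving the severed ends to three given points of the real axis\<close>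

text \<open>A connected set with two points is infinite. The point obtained will be the pole of a
  Cayley map.\<close>

lemma sphere_point_outside_finite:
  fixes x :: complex
  assumes "finite Q" "0 < R"
  obtains z where "z \<in> sphere x R" "z \<notin> Q"
proof -
  have "x + of_real R \<in> sphere x R" "x - of_real R \<in> sphere x R" "x + of_real R \<noteq> x - of_real R"
    using assms(2) by (auto simp: dist_norm)
  then have "infinite (sphere x R)"
    using connected_finite_iff_sing[OF connected_sphere[of x R]] by (metis DIM_complex empty_iff order_refl singletonD)
  then show ?thesis using that assms(1) by (meson finite_subset subsetI)
qed

text \<open>With \<open>a = z - w\<close> and \<open>b = s - w\<close> the map is
  \<open>\<i> * (a + b) / (a - b)\<close>, and the real part of \<open>(a + b) * cnj (a - b)\<close>
  is the difference of the squared moduli. So the circle around \<open>w\<close> through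
  \<open>s\<close> goes to the real axis and its exterior to the upper half plane.\<close>

lemma Im_cayley:
  fixes z w s :: complex
  assumes "z \<noteq> s"
  shows "Im (\<i> * (z + s - 2 * w) / (z - s)) = ((cmod (z - w))\<^sup>2 - (cmod (s - w))\<^sup>2) / (cmod (z - s))\<^sup>2"
proof -
  define a b where "a = z - w" and "b = s - w"
  have "z + s - 2 * w = a + b" "z - s = a - b" by (simp_all add: a_def b_def)
  moreover have "Re ((a + b) * cnj (a - b)) = (cmod a)\<^sup>2 - (cmod b)\<^sup>2"
    unfolding cmod_power2 by (simp add: algebra_simps power2_eq_square)
  then have "Re ((a + b) / (a - b)) = ((cmod a)\<^sup>2 - (cmod b)\<^sup>2) / (cmod (a - b))\<^sup>2"
    by (simp add: complex_div_cnj[of "a + b"] flip: of_real_power)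
  then have "Im (\<i> * (a + b) / (a - b)) = ((cmod a)\<^sup>2 - (cmod b)\<^sup>2) / (cmod (a - b))\<^sup>2"
    unfolding times_divide_eq_right[symmetric] by (simp only: Im_i_times)
  ultimately show ?thesis by (simp add: a_def b_def)
qed

text \<open>A Moebius map with real coefficients preserves or exchanges the half planes according to
  the sign of its determinant \<Delta>. If they are exchanged, conjugation corrects this and fixes
  the real axis; thus the order of the three points does not matter.\<close>

lemma real_moebius:
  fixes x1 x2 x3 :: real
  assumes "x1 \<noteq> x2" "x1 \<noteq> x3" "x2 \<noteq> x3"
  obtains f where "inj_on f ({z. 0 < Im z} \<union> {complex_of_real x1, complex_of_real x2, complex_of_real x3})"
    "continuous_on ({z. 0 < Im z} \<union> {complex_of_real x1, complex_of_real x2, complex_of_real x3}) f"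
    "\<And>z. 0 < Im z \<Longrightarrow> 0 < Im (f z)"
    "f x1 = 0" "f x2 = 1" "f x3 = -1"
proof -
  \<comment> \<open>The numerator is \<open>(x2 - x3) * (z - x1)\<close>, with zero
    \<open>x1\<close>; the denominator is the linear function that agrees with it at
    \<open>x2\<close> and is its negative at \<open>x3\<close>.\<close>
  define \<alpha> \<beta> \<gamma> \<delta> where "\<alpha> = x2 - x3" and "\<beta> = - x1 * (x2 - x3)"
    and "\<gamma> = 2 * (x2 - x1) - (x2 - x3)" and "\<delta> = x1 * (x2 - x3) - 2 * x3 * (x2 - x1)"
  define N D where "N = (\<lambda>z. complex_of_real \<alpha> * z + complex_of_real \<beta>)"
    and "D = (\<lambda>z. complex_of_real \<gamma> * z + complex_of_real \<delta>)"
  define \<Delta> where "\<Delta> = \<alpha> * \<delta> - \<beta> * \<gamma>"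
  have "\<Delta> = 2 * (x2 - x3) * (x2 - x1) * (x1 - x3)"
    unfolding \<Delta>_def \<alpha>_def \<beta>_def \<gamma>_def \<delta>_def by (simp add: algebra_simps)
  then have \<Delta>0: "\<Delta> \<noteq> 0" using assms by simp
  have at_x: "N x1 = 0" "D x1 = complex_of_real (2 * (x2 - x1) * (x1 - x3))"
    "N x2 = complex_of_real ((x2 - x3) * (x2 - x1))" "D x2 = complex_of_real ((x2 - x3) * (x2 - x1))"
    "N x3 = complex_of_real ((x3 - x1) * (x2 - x3))" "D x3 = - N x3"
    unfolding N_def D_def \<alpha>_def \<beta>_def \<gamma>_def \<delta>_def
    by (simp_all add: algebra_simps flip: of_real_mult of_real_add)
  have D_up: "D z \<noteq> 0" if "0 < Im z" for z
  proof
    assume "D z = 0"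
    then have "\<gamma> * Im z = 0" "\<gamma> * Re z + \<delta> = 0" by (auto simp: D_def complex_eq_iff)
    then have "\<gamma> = 0" "\<delta> = 0" using that by auto
    then show False using \<Delta>0 by (simp add: \<Delta>_def)
  qed
  let ?S = "{z. 0 < Im z} \<union> {complex_of_real x1, complex_of_real x2, complex_of_real x3}"
  have D0: "D z \<noteq> 0" if "z \<in> ?S" for z
    using that D_up at_x(2,4,5,6) assms by (auto simp del: of_real_mult)
  define M where "M = (\<lambda>z. N z / D z)"
  have M_inj: "inj_on M ?S"
  proof (rule inj_onI)
    fix x y assume xy: "x \<in> ?S" "y \<in> ?S" "M x = M y"
    then have "N x * D y = N y * D x" using D0[OF xy(1)] D0[OF xy(2)] by (simp add: M_def divide_simps)
    then have "complex_of_real \<Delta> * (x - y) = 0" by (simp add: N_def D_def \<Delta>_def algebra_simps)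
    then show "x = y" using \<Delta>0 by simp
  qed
  have M_cont: "continuous_on ?S M"
    unfolding M_def using D0 by (intro continuous_on_divide) (auto simp: N_def D_def intro!: continuous_intros)
  have M_Im: "Im (M z) = \<Delta> * Im z / (cmod (D z))\<^sup>2" if "0 < Im z" for z
  proof -
    have "Im (N z * cnj (D z)) = \<Delta> * Im z"
      by (simp add: N_def D_def \<Delta>_def algebra_simps)
    then show ?thesis
      unfolding M_def by (simp add: complex_div_cnj[of "N z"] flip: of_real_power)
  qed
  have M_x: "M x1 = 0" "M x2 = 1" "M x3 = -1"
    using at_x assms by (simp_all add: M_def divide_simps del: of_real_mult)
  define f where "f = (if \<Delta> > 0 then M else cnj \<circ> M)"
  show ?thesis
  proof (rule that)
    show "inj_on f ?S" using M_inj by (auto simp: f_def inj_on_def)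
    show "continuous_on ?S f" using M_cont by (auto simp: f_def intro!: continuous_intros)
    show "0 < Im (f z)" if "0 < Im z" for z
      using M_Im[OF that] D_up[OF that] that \<Delta>0
      by (auto simp: f_def zero_less_divide_iff divide_less_0_iff mult_less_0_iff)
    show "f x1 = 0" "f x2 = 1" "f x3 = -1" using M_x by (simp_all add: f_def)
  qed
qed

text \<open>The exterior of the disc is sent to the upper half plane by a Cayley map; a real Moebius
  map, possibly followed by conjugation, then puts the ends of the stubs in standard
  position.\<close>

lemma spokes_half_plane:
  assumes G: "plane_embedding G p c" and simple: "simple_graph G"
    and star: "{e \<in> edges G. w \<in> e} = {{w, a1}, {w, a2}, {w, a3}}"
    and distinct: "distinct [a1, a2, a3]"
  obtains p' c' r where
    "spokes \<lparr>verts = verts G - {w}, edges = {e \<in> edges G. w \<notin> e}\<rparr> p' c' {a1, a2, a3} r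
       {z. 0 < Im z} {0, 1, -1}"
    "pathfinish (r a1) = 0" "pathfinish (r a2) = 1" "pathfinish (r a3) = -1"
proof -
  let ?G = "\<lparr>verts = verts G - {w}, edges = {e \<in> edges G. w \<notin> e}\<rparr>"
  let ?A = "{a1, a2, a3}"
  have "{w, a1} \<in> edges G" using star by blast
  then have w: "w \<in> verts G" using simple by (auto simp: simple_graph_def)
  have AV: "?A \<subseteq> verts ?G"
  proof -
    have "{w, a} \<in> edges G" if "a \<in> ?A" for a using star that by blast
    then have "a \<in> verts G" "a \<noteq> w" if "a \<in> ?A" for a
      using that simple unfolding simple_graph_def by (force, force)
    then show ?thesis by auto
  qed
  have star': "{e \<in> edges G. w \<in> e} = (\<lambda>a. {w, a}) ` ?A" using star by auto
  obtain r R where R: "0 < R" and sp: "spokes ?G p c ?A r (- cball (p w) R) (sphere (p w) R)"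
    using spokes_outside_disc[OF G simple w star'] .
  let ?q = "\<lambda>a. pathfinish (r a)"
  \<comment> \<open>The pole has to lie on the circle, so that the circle becomes a line, and off
    the ends of the stubs.\<close>
  obtain s where s: "s \<in> sphere (p w) R" "s \<notin> ?q ` ?A"
    using sphere_point_outside_finite[of "?q ` ?A" R "p w"] R by blast
  have q: "?q a \<in> sphere (p w) R" "?q a \<noteq> s" if "a \<in> ?A" for a
    using spokesD(5)[OF sp that] s(2) that by auto
  define f where "f = (\<lambda>z. \<i> * (z + s - 2 * p w) / (z - s))"
  let ?W = "- cball (p w) R \<union> ?q ` ?A"
  have sW: "s \<notin> ?W" using s by auto
  have Rs: "cmod (s - p w) = R" using s by (simp add: dist_norm norm_minus_commute)
  have Im_f: "Im (f z) = ((cmod (z - p w))\<^sup>2 - R\<^sup>2) / (cmod (z - s))\<^sup>2" if "z \<noteq> s" for z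
    using Im_cayley[OF that, of "p w"] by (simp add: f_def Rs)
  have f_inj: "inj_on f ?W"
  proof (rule inj_onI)
    fix x y assume xy: "x \<in> ?W" "y \<in> ?W" "f x = f y"
    then have ne: "x \<noteq> s" "y \<noteq> s" using sW by blast+
    then have "(x + s - 2 * p w) * (y - s) = (y + s - 2 * p w) * (x - s)"
      using xy(3) by (simp add: f_def divide_simps)
    then have "2 * ((x - y) * (s - p w)) = 0" by (simp add: algebra_simps)
    then show "x = y" using Rs R by auto
  qed
  have f_cont: "continuous_on ?W f"
    unfolding f_def using sW by (intro continuous_intros) auto
  have sp1: "spokes ?G (f \<circ> p) (\<lambda>e. f \<circ> c e) ?A (\<lambda>a. f \<circ> r a) {z. 0 < Im z} {z. Im z = 0}"
  proof (rule spokes_transport[OF sp AV f_inj f_cont])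
    show "f ` (- cball (p w) R) \<subseteq> {z. 0 < Im z}"
    proof
      fix y assume "y \<in> f ` (- cball (p w) R)"
      then obtain z where z: "y = f z" "z \<notin> cball (p w) R" by auto
      then have zs: "z \<noteq> s" using s by auto
      have "R < cmod (z - p w)" using z by (simp add: dist_norm norm_minus_commute)
      then have "R\<^sup>2 < (cmod (z - p w))\<^sup>2" using R by (intro power_strict_mono) auto
      then show "y \<in> {z. 0 < Im z}" using zs by (simp add: z Im_f)
    qed
    show "f (?q a) \<in> {z. Im z = 0}" if "a \<in> ?A" for a
      using q[OF that] by (simp add: Im_f dist_norm norm_minus_commute)
  qed
  let ?x = "\<lambda>a. Re (f (?q a))"
  have fq: "f (?q a) = complex_of_real (?x a)" if "a \<in> ?A" for a
    using q[OF that] by (simp add: Im_f complex_eq_iff dist_norm norm_minus_commute)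
  have x_ne: "?x a \<noteq> ?x a'" if a: "a \<in> ?A" "a' \<in> ?A" "a \<noteq> a'" for a a'
  proof
    assume "?x a = ?x a'"
    then have "f (?q a) = f (?q a')" using fq[OF a(1)] fq[OF a(2)] by simp
    then have "?q a = ?q a'" by (rule inj_onD[OF f_inj]) (use a in blast)+
    moreover have "path_image (r a) \<inter> path_image (r a') = {}" using spokesD(8)[OF sp a] .
    ultimately show False using pathfinish_in_path_image by (metis IntI empty_iff)
  qed
  obtain h where h: "inj_on h ({z. 0 < Im z} \<union> {complex_of_real (?x a1), complex_of_real (?x a2), complex_of_real (?x a3)})"
    "continuous_on ({z. 0 < Im z} \<union> {complex_of_real (?x a1), complex_of_real (?x a2), complex_of_real (?x a3)}) h"
    "\<And>z. 0 < Im z \<Longrightarrow> 0 < Im (h z)"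
    "h (?x a1) = 0" "h (?x a2) = 1" "h (?x a3) = -1"
    using real_moebius[of "?x a1" "?x a2" "?x a3"] x_ne distinct by auto
  have fin: "(\<lambda>a. pathfinish (f \<circ> r a)) ` ?A = {complex_of_real (?x a1), complex_of_real (?x a2), complex_of_real (?x a3)}"
    using fq by (simp add: pathfinish_compose)
  have sp2: "spokes ?G (h \<circ> (f \<circ> p)) (\<lambda>e. h \<circ> (f \<circ> c e)) ?A (\<lambda>a. h \<circ> (f \<circ> r a)) {z. 0 < Im z} {0, 1, -1}"
    by (rule spokes_transport[OF sp1 AV]) (use h fq in \<open>auto simp: fin pathfinish_compose\<close>)
  show ?thesis
    by (rule that[OF sp2]) (use h fq in \<open>auto simp: pathfinish_compose\<close>)
qed

section \<open>Joining two drawings across the real axis\<close>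

lemma simple_graph_insert_edge:
  assumes "simple_graph G" "a \<in> verts G" "b \<in> verts G" "a \<noteq> b"
  shows "simple_graph \<lparr>verts = verts G, edges = insert {a, b} (edges G)\<rparr>"
  using assms by (auto simp: simple_graph_def)

lemma drawing_insert_edge:
  assumes "{a, b} \<notin> edges G"
  shows "drawing \<lparr>verts = verts G, edges = insert {a, b} (edges G)\<rparr> p (c({a, b} := \<gamma>))
    = drawing G p c \<union> path_image \<gamma>"
proof -
  have "(\<Union>e\<in>edges G. path_image ((c({a, b} := \<gamma>)) e)) = (\<Union>e\<in>edges G. path_image (c e))"
    using assms by (intro SUP_cong) auto
  then show ?thesis by (auto simp: drawing_def)
qed

lemma plane_embedding_disjoint_union:
  assumes G1: "plane_embedding G1 p1 c1" and G2: "plane_embedding G2 p2 c2"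
    and simple: "simple_graph G1" "simple_graph G2"
    and V: "verts G1 \<inter> verts G2 = {}"
    and D: "drawing G1 p1 c1 \<inter> drawing G2 p2 c2 = {}"
  defines "p \<equiv> \<lambda>v. if v \<in> verts G1 then p1 v else p2 v"
    and "c \<equiv> \<lambda>e. if e \<in> edges G1 then c1 e else c2 e"
    and "G \<equiv> \<lparr>verts = verts G1 \<union> verts G2, edges = edges G1 \<union> edges G2\<rparr>"
  shows "plane_embedding G p c" "drawing G p c = drawing G1 p1 c1 \<union> drawing G2 p2 c2"
proof -
  have e1: "e \<subseteq> verts G1" "e \<noteq> {}" if "e \<in> edges G1" for e using that simple by (auto simp: simple_graph_def)
  have e2: "e \<subseteq> verts G2" "e \<noteq> {}" if "e \<in> edges G2" for e using that simple by (auto simp: simple_graph_def)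
  have c: "c e = c1 e" if "e \<in> edges G1" for e using that by (simp add: c_def)
  have "e \<notin> edges G1" if "e \<in> edges G2" for e using e1[of e] e2[of e] V that by blast
  then have c': "c e = c2 e" if "e \<in> edges G2" for e using that by (simp add: c_def)
  have p: "p v = p1 v" if "v \<in> verts G1" for v using that by (simp add: p_def)
  have p': "p v = p2 v" if "v \<in> verts G2" for v using that V by (auto simp: p_def)
  have pe: "p ` e = p1 ` e" if "e \<subseteq> verts G1" for e using p that by (intro image_cong) auto
  have pe': "p ` e = p2 ` e" if "e \<subseteq> verts G2" for e using p' that by (intro image_cong) auto
  show Deq: "drawing G p c = drawing G1 p1 c1 \<union> drawing G2 p2 c2"
    unfolding drawing_def G_def using pe[OF order_refl] pe'[OF order_refl] c c' by (auto simp: image_Un)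
  have vD: "p1 v \<in> drawing G1 p1 c1" if "v \<in> verts G1" for v using that by (auto simp: drawing_def)
  have vD': "p2 v \<in> drawing G2 p2 c2" if "v \<in> verts G2" for v using that by (auto simp: drawing_def)
  have eD: "path_image (c1 e) \<subseteq> drawing G1 p1 c1" if "e \<in> edges G1" for e using that by (auto simp: drawing_def)
  have eD': "path_image (c2 e) \<subseteq> drawing G2 p2 c2" if "e \<in> edges G2" for e using that by (auto simp: drawing_def)
  show "plane_embedding G p c"
    unfolding plane_embedding_def
  proof (intro conjI ballI impI)
    have "inj_on p (verts G1)" "inj_on p (verts G2)"
      using plane_embedding_inj[OF G1] plane_embedding_inj[OF G2] p p' by (simp_all add: inj_on_def)
    moreover have "p ` verts G1 \<inter> p ` verts G2 = {}"
      using pe[OF order_refl] pe'[OF order_refl] D by (auto simp: drawing_def)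
    ultimately show "inj_on p (verts G)"
      by (auto simp: G_def inj_on_Un)
    fix e assume "e \<in> edges G"
    then consider "e \<in> edges G1" | "e \<in> edges G2" by (auto simp: G_def)
    note cs = this
    show "arc (c e)" using cs
      by cases (simp_all add: c c' plane_embedding_edgeD(1)[OF G1] plane_embedding_edgeD(1)[OF G2])
    show "{pathstart (c e), pathfinish (c e)} = p ` e" using cs
      by cases (simp_all add: c c' plane_embedding_edgeD(2)[OF G1] plane_embedding_edgeD(2)[OF G2] pe pe' e1 e2)
    show "v \<in> e" if v: "v \<in> verts G" "p v \<in> path_image (c e)" for v
    proof -
      consider "v \<in> verts G1" | "v \<in> verts G2" using v(1) by (auto simp: G_def)
      then show ?thesis
      proof cases
        case 1
        from cs show ?thesis
        proof cases
          case e: 1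
          then show ?thesis using plane_embedding_edgeD(3)[OF G1 e] v(2) p[OF 1] 1 by (simp add: c)
        next
          case e: 2
          then show ?thesis using eD'[OF e] vD[OF 1] D v(2) p[OF 1] by (auto simp: c')
        qed
      next
        case 2
        from cs show ?thesis
        proof cases
          case e: 1
          then show ?thesis using eD[OF e] vD'[OF 2] D v(2) p'[OF 2] by (auto simp: c)
        next
          case e: 2
          then show ?thesis using plane_embedding_edgeD(3)[OF G2 e] v(2) p'[OF 2] 2 by (simp add: c')
        qed
      qed
    qed
    fix e' assume "e' \<in> edges G" and ne: "e \<noteq> e'"
    then consider "e' \<in> edges G1" | "e' \<in> edges G2" by (auto simp: G_def)
    note cs' = this
    have Int1: "p ` (e \<inter> e') = p1 ` (e \<inter> e')" if "e \<in> edges G1"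
      using e1(1)[OF that] by (intro pe) blast
    have Int2: "p ` (e \<inter> e') = p2 ` (e \<inter> e')" if "e \<in> edges G2"
      using e2(1)[OF that] by (intro pe') blast
    from cs show "path_image (c e) \<inter> path_image (c e') \<subseteq> p ` (e \<inter> e')"
    proof cases
      case e: 1
      from cs' show ?thesis
      proof cases
        case 1
        then show ?thesis using plane_embedding_edgeD(4)[OF G1 e 1 ne] Int1[OF e] e by (simp add: c)
      next
        case 2
        then show ?thesis using eD[OF e] eD'[OF 2] D by (simp only: c[OF e] c'[OF 2]) blast
      qed
    next
      case e: 2
      from cs' show ?thesis
      proof cases
        case 1
        then show ?thesis using eD'[OF e] eD[OF 1] D by (simp only: c'[OF e] c[OF 1]) blast
      next
        case 2
        then show ?thesis using plane_embedding_edgeD(4)[OF G2 e 2 ne] Int2[OF e] e by (simp add: c')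
      qed
    qed
  qed
qed

text \<open>The two drawings lie in opposite open half planes, and corresponding stubs meet the real
  axis in the same point. Each pair of stubs therefore joins to one arc, and arcs of different pairs
  are disjoint.\<close>

lemma planar_glue_at_degree_3:
  assumes planar: "planar G1" "planar G2" and simple: "simple_graph G1" "simple_graph G2"
    and V: "verts G1 \<inter> verts G2 = {}"
    and star1: "{e \<in> edges G1. w1 \<in> e} = {{w1, a1}, {w1, a2}, {w1, a3}}" and dist1: "distinct [a1, a2, a3]"
    and star2: "{e \<in> edges G2. w2 \<in> e} = {{w2, b1}, {w2, b2}, {w2, b3}}" and dist2: "distinct [b1, b2, b3]"
  shows "planar \<lparr>verts = (verts G1 - {w1}) \<union> (verts G2 - {w2}),
     edges = {e \<in> edges G1. w1 \<notin> e} \<union> {e \<in> edges G2. w2 \<notin> e} \<union> {{a1, b1}, {a2, b2}, {a3, b3}}\<rparr>"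
proof -
  let ?G1 = "\<lparr>verts = verts G1 - {w1}, edges = {e \<in> edges G1. w1 \<notin> e}\<rparr>"
  let ?G2 = "\<lparr>verts = verts G2 - {w2}, edges = {e \<in> edges G2. w2 \<notin> e}\<rparr>"
  obtain p1 c1 r1 where sp1: "spokes ?G1 p1 c1 {a1, a2, a3} r1 {z. 0 < Im z} {0, 1, -1}"
    and f1: "pathfinish (r1 a1) = 0" "pathfinish (r1 a2) = 1" "pathfinish (r1 a3) = -1"
  proof -
    obtain p c where "plane_embedding G1 p c" using planar(1) unfolding planar_def by blast
    from spokes_half_plane[OF this simple(1) star1 dist1] that show ?thesis by blast
  qed
  obtain p2' c2' r2' where sp2': "spokes ?G2 p2' c2' {b1, b2, b3} r2' {z. 0 < Im z} {0, 1, -1}"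
    and f2': "pathfinish (r2' b1) = 0" "pathfinish (r2' b2) = 1" "pathfinish (r2' b3) = -1"
  proof -
    obtain p c where "plane_embedding G2 p c" using planar(2) unfolding planar_def by blast
    from spokes_half_plane[OF this simple(2) star2 dist2] that show ?thesis by blast
  qed
  have A: "{a1, a2, a3} \<subseteq> verts G1 - {w1}"
  proof -
    have "{w1, a1} \<in> edges G1" "{w1, a2} \<in> edges G1" "{w1, a3} \<in> edges G1" using star1 by blast+
    then show ?thesis using simple_graph_edgeD(2,3)[OF simple(1)] by auto
  qed
  have B: "{b1, b2, b3} \<subseteq> verts G2 - {w2}"
  proof -
    have "{w2, b1} \<in> edges G2" "{w2, b2} \<in> edges G2" "{w2, b3} \<in> edges G2" using star2 by blast+
    then show ?thesis using simple_graph_edgeD(2,3)[OF simple(2)] by auto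
  qed
  \<comment> \<open>Conjugation moves the second drawing to the lower half plane and fixes the ends
    0, 1, -1 of its stubs.\<close>
  define p2 c2 r2 where "p2 = cnj \<circ> p2'" and "c2 = (\<lambda>e. cnj \<circ> c2' e)" and "r2 = (\<lambda>b. cnj \<circ> r2' b)"
  have sp2: "spokes ?G2 p2 c2 {b1, b2, b3} r2 {z. Im z < 0} {0, 1, -1}"
    unfolding p2_def c2_def r2_def
    by (rule spokes_transport[OF sp2']) (use B f2' in \<open>auto intro!: continuous_intros simp: inj_on_def\<close>)
  have f2: "pathfinish (r2 b1) = 0" "pathfinish (r2 b2) = 1" "pathfinish (r2 b3) = -1"
    using f2' by (simp_all add: r2_def pathfinish_compose)
  let ?D1 = "drawing ?G1 p1 c1" and ?D2 = "drawing ?G2 p2 c2"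
  have up: "z \<in> ?D1 \<Longrightarrow> 0 < Im z" for z using spokesD(2)[OF sp1] by blast
  have down: "z \<in> ?D2 \<Longrightarrow> Im z < 0" for z using spokesD(2)[OF sp2] by blast
  define G p c where "G = \<lparr>verts = verts ?G1 \<union> verts ?G2, edges = edges ?G1 \<union> edges ?G2\<rparr>"
    and "p = (\<lambda>v. if v \<in> verts ?G1 then p1 v else p2 v)"
    and "c = (\<lambda>e. if e \<in> edges ?G1 then c1 e else c2 e)"
  have s: "simple_graph ?G1" "simple_graph ?G2" using simple by (auto simp: simple_graph_def)
  have G: "plane_embedding G p c" "drawing G p c = ?D1 \<union> ?D2"
  proof -
    have V': "verts ?G1 \<inter> verts ?G2 = {}" using V by auto
    have D: "?D1 \<inter> ?D2 = {}" using up down by fastforce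
    note u = plane_embedding_disjoint_union[OF spokesD(1)[OF sp1] spokesD(1)[OF sp2] s V' D]
    show "plane_embedding G p c" using u(1) unfolding G_def p_def c_def .
    show "drawing G p c = ?D1 \<union> ?D2" using u(2) unfolding G_def p_def c_def .
  qed
  have sG: "simple_graph G" using s by (auto simp: G_def simple_graph_def)
  define \<gamma> where "\<gamma> = (\<lambda>a b. r1 a +++ reversepath (r2 b))"
  let ?I = "{(a1, b1), (a2, b2), (a3, b3)}"
  have r1: "arc (r1 a)" "pathstart (r1 a) = p1 a" "path_image (r1 a) - {pathfinish (r1 a)} \<subseteq> {z. 0 < Im z}"
    "path_image (r1 a) \<inter> ?D1 \<subseteq> {p1 a}" "Im (pathfinish (r1 a)) = 0" if "a \<in> {a1, a2, a3}" for a
    using spokesD(3,4,6,7)[OF sp1 that] that f1 by auto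
  have r2: "arc (r2 b)" "pathstart (r2 b) = p2 b" "path_image (r2 b) - {pathfinish (r2 b)} \<subseteq> {z. Im z < 0}"
    "path_image (r2 b) \<inter> ?D2 \<subseteq> {p2 b}" "Im (pathfinish (r2 b)) = 0" if "b \<in> {b1, b2, b3}" for b
    using spokesD(3,4,6,7)[OF sp2 that] that f2 by auto
  have r1_Im: "z = pathfinish (r1 a) \<or> 0 < Im z" if "z \<in> path_image (r1 a)" "a \<in> {a1, a2, a3}" for z a
    using r1(3)[OF that(2)] that(1) by blast
  have r2_Im: "z = pathfinish (r2 b) \<or> Im z < 0" if "z \<in> path_image (r2 b)" "b \<in> {b1, b2, b3}" for z b
    using r2(3)[OF that(2)] that(1) by blast
  have mem: "a \<in> {a1, a2, a3}" "b \<in> {b1, b2, b3}" "pathfinish (r1 a) = pathfinish (r2 b)" if "(a, b) \<in> ?I" for a b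
    using that f1 f2 by auto
  have pab: "p a = p1 a" "p b = p2 b" "a \<in> verts G" "b \<in> verts G" "a \<noteq> b" if "(a, b) \<in> ?I" for a b
    using A B V mem[OF that] by (auto simp: p_def G_def)
  have \<gamma>: "arc (\<gamma> a b)" "pathstart (\<gamma> a b) = p a" "pathfinish (\<gamma> a b) = p b"
    "path_image (\<gamma> a b) = path_image (r1 a) \<union> path_image (r2 b)" if ab: "(a, b) \<in> ?I" for a b
  proof -
    note m = mem[OF ab]
    show "pathstart (\<gamma> a b) = p a" "pathfinish (\<gamma> a b) = p b"
      using r1(2)[OF m(1)] r2(2)[OF m(2)] pab[OF ab] by (simp_all add: \<gamma>_def)
    show "path_image (\<gamma> a b) = path_image (r1 a) \<union> path_image (r2 b)"
      using m(3) by (simp add: \<gamma>_def path_image_join)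
    have "z = pathfinish (r1 a)" if "z \<in> path_image (r1 a)" "z \<in> path_image (r2 b)" for z
      using r1_Im[OF that(1) m(1)] r2_Im[OF that(2) m(2)] m(3) by auto
    then show "arc (\<gamma> a b)"
      unfolding \<gamma>_def using r1(1)[OF m(1)] r2(1)[OF m(2)] m(3)
      by (intro arc_join arc_reversepath) auto
  qed
  have \<gamma>_D: "path_image (\<gamma> a b) \<inter> drawing G p c \<subseteq> {p a, p b}" if ab: "(a, b) \<in> ?I" for a b
  proof -
    note m = mem[OF ab]
    have "path_image (r1 a) \<inter> ?D2 = {}" "path_image (r2 b) \<inter> ?D1 = {}"
      using r1_Im[OF _ m(1)] r1(5)[OF m(1)] down r2_Im[OF _ m(2)] r2(5)[OF m(2)] up by fastforce+
    then show ?thesis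
      unfolding \<gamma>(4)[OF ab] G(2) pab(1,2)[OF ab] using r1(4)[OF m(1)] r2(4)[OF m(2)] by blast
  qed
  have \<gamma>_\<gamma>: "path_image (\<gamma> a b) \<inter> path_image (\<gamma> a' b') = {}" if ab: "(a, b) \<in> ?I" "(a', b') \<in> ?I" "a \<noteq> a'" for a b a' b'
  proof -
    note m = mem[OF ab(1)] and m' = mem[OF ab(2)]
    have bb: "b \<noteq> b'" using ab dist1 dist2 by auto
    have "path_image (r1 a) \<inter> path_image (r1 a') = {}" "path_image (r2 b) \<inter> path_image (r2 b') = {}"
      using spokesD(8)[OF sp1 m(1) m'(1) ab(3)] spokesD(8)[OF sp2 m(2) m'(2) bb] .
    moreover have "pathfinish (r1 a) \<noteq> pathfinish (r1 a')" using ab f1 by auto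
    then have "path_image (r1 a) \<inter> path_image (r2 b') = {}" "path_image (r2 b) \<inter> path_image (r1 a') = {}"
      using r1_Im[OF _ m(1)] r1_Im[OF _ m'(1)] r2_Im[OF _ m(2)] r2_Im[OF _ m'(2)]
        r1(5)[OF m(1)] r1(5)[OF m'(1)] m(3) m'(3) by fastforce+
    ultimately show ?thesis unfolding \<gamma>(4)[OF ab(1)] \<gamma>(4)[OF ab(2)] by blast
  qed
  have new: "{a, b} \<notin> edges G" if "(a, b) \<in> ?I" for a b
    using A B V s mem[OF that] by (auto simp: G_def simple_graph_def)
  have ne: "{a1, b1} \<noteq> {a2, b2}" "{a1, b1} \<noteq> {a3, b3}" "{a2, b2} \<noteq> {a3, b3}"
    using dist1 A B V by (auto simp: doubleton_eq_iff)
  have i: "(a1, b1) \<in> ?I" "(a2, b2) \<in> ?I" "(a3, b3) \<in> ?I" by simp_all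
  \<comment> \<open>The three new edges are inserted one at a time; each must also avoid the arcs
    inserted before it.\<close>
  let ?H1 = "\<lparr>verts = verts G, edges = insert {a1, b1} (edges G)\<rparr>"
  let ?c1 = "c({a1, b1} := \<gamma> a1 b1)"
  have H1: "plane_embedding ?H1 p ?c1"
    by (rule plane_embedding_insert_edge[OF G(1) pab(3,4)[OF i(1)] \<gamma>(1-3)[OF i(1)] \<gamma>_D[OF i(1)] sG new[OF i(1)]])
  have D1: "drawing ?H1 p ?c1 = drawing G p c \<union> path_image (\<gamma> a1 b1)"
    by (rule drawing_insert_edge[OF new[OF i(1)]])
  have s1: "simple_graph ?H1" by (rule simple_graph_insert_edge[OF sG pab(3-5)[OF i(1)]])
  let ?H2 = "\<lparr>verts = verts ?H1, edges = insert {a2, b2} (edges ?H1)\<rparr>"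
  let ?c2 = "?c1({a2, b2} := \<gamma> a2 b2)"
  have pab2: "a2 \<in> verts ?H1" "b2 \<in> verts ?H1" using pab(3,4)[OF i(2)] by simp_all
  have new2: "{a2, b2} \<notin> edges ?H1" using new[OF i(2)] ne by simp
  have m2: "path_image (\<gamma> a2 b2) \<inter> drawing ?H1 p ?c1 \<subseteq> {p a2, p b2}"
    unfolding D1 using \<gamma>_D[OF i(2)] \<gamma>_\<gamma>[OF i(2,1)] dist1 by auto
  have H2: "plane_embedding ?H2 p ?c2"
    by (rule plane_embedding_insert_edge[OF H1 pab2 \<gamma>(1-3)[OF i(2)] m2 s1 new2])
  have D2: "drawing ?H2 p ?c2 = drawing G p c \<union> path_image (\<gamma> a1 b1) \<union> path_image (\<gamma> a2 b2)"
    unfolding drawing_insert_edge[OF new2] D1 ..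
  have s2: "simple_graph ?H2" by (rule simple_graph_insert_edge[OF s1 pab2 pab(5)[OF i(2)]])
  have pab3: "a3 \<in> verts ?H2" "b3 \<in> verts ?H2" using pab(3,4)[OF i(3)] by simp_all
  have new3: "{a3, b3} \<notin> edges ?H2" using new[OF i(3)] ne by simp
  have m3: "path_image (\<gamma> a3 b3) \<inter> drawing ?H2 p ?c2 \<subseteq> {p a3, p b3}"
    unfolding D2 using \<gamma>_D[OF i(3)] \<gamma>_\<gamma>[OF i(3,1)] \<gamma>_\<gamma>[OF i(3,2)] dist1 by auto
  have "plane_embedding \<lparr>verts = verts ?H2, edges = insert {a3, b3} (edges ?H2)\<rparr> p (?c2({a3, b3} := \<gamma> a3 b3))"
    by (rule plane_embedding_insert_edge[OF H2 pab3 \<gamma>(1-3)[OF i(3)] m3 s2 new3])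
  then have "planar \<lparr>verts = verts ?H2, edges = insert {a3, b3} (edges ?H2)\<rparr>"
    unfolding planar_def by blast
  then show ?thesis by (rule planar_subgraph) (auto simp: G_def)
qed

section \<open>Planarity\<close>

text \<open>The construction uses four auxiliary vertices, but the type \<open>'a\<close> may have
  no elements left. Mapping along \<open>Inl\<close> into \<open>'a + nat\<close> makes room for
  them.\<close>

definition map_graph :: "('a \<Rightarrow> 'b) \<Rightarrow> 'a sgraph \<Rightarrow> 'b sgraph" where
  "map_graph f G = \<lparr>verts = f ` verts G, edges = (`) f ` edges G\<rparr>"

lemma verts_map_graph [simp]: "verts (map_graph f G) = f ` verts G"
  and edges_map_graph [simp]: "edges (map_graph f G) = (`) f ` edges G"
  by (simp_all add: map_graph_def)

lemma simple_graph_map_graph: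
  assumes "inj f" "simple_graph G"
  shows "simple_graph (map_graph f G)"
  using assms by (auto simp: simple_graph_def card_image inj_on_subset)

text \<open>Both directions are used: the given embeddings are carried to the larger type, and the
  resulting one is pulled back.\<close>

lemma plane_embedding_map_graph:
  assumes f: "inj f"
  shows "plane_embedding (map_graph f G) p c \<longleftrightarrow> plane_embedding G (p \<circ> f) (\<lambda>e. c (f ` e))"
proof -
  have "inj_on p (f ` verts G) \<longleftrightarrow> inj_on (p \<circ> f) (verts G)"
    using f by (simp add: comp_inj_on_iff inj_on_subset)
  moreover have "f ` e = f ` e' \<longleftrightarrow> e = e'" for e e' using f by (rule inj_image_eq_iff)
  moreover have "f v \<in> f ` e \<longleftrightarrow> v \<in> e" for v e using f by (rule inj_image_mem_iff)
  moreover have "f ` e \<inter> f ` e' = f ` (e \<inter> e')" for e e' using f by (rule image_Int[symmetric])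
  ultimately show ?thesis
    by (simp add: plane_embedding_def image_comp)
qed

lemma drawing_map_graph:
  "drawing (map_graph f G) p c = drawing G (p \<circ> f) (\<lambda>e. c (f ` e))"
  by (simp add: drawing_def image_comp)

lemma path3_map_graph:
  assumes f: "inj f" and "path3_in_face_boundary G (p \<circ> f) (\<lambda>e. c (f ` e)) x y z"
  shows "path3_in_face_boundary (map_graph f G) p c (f x) (f y) (f z)"
proof -
  have "f ` {x, y} \<in> (`) f ` edges G" "f ` {y, z} \<in> (`) f ` edges G"
    using assms(2) by (auto simp only: path3_in_face_boundary_def intro: imageI)
  then show ?thesis
    using assms(2) inj_eq[OF f] by (auto simp: path3_in_face_boundary_def faces_def drawing_map_graph)
qed

section \<open>Attaching, gluing and removing the auxiliary vertices\<close>

lemma edges_at_Un: "(\<And>e. e \<in> A \<Longrightarrow> w \<notin> e) \<Longrightarrow> {e \<in> A \<union> B. w \<in> e} = {e \<in> B. w \<in> e}"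
  by auto

text \<open>Here \<open>m\<close> subdivides \<open>xy\<close>, \<open>m'\<close> subdivides
  \<open>yz\<close>, and the two are joined through the face. The vertex \<open>m'\<close> then has
  exactly the neighbours \<open>y\<close>, \<open>m\<close>, \<open>z\<close>, so first the lost
  edge \<open>yz\<close> and then \<open>mz\<close> can be added at it. The edge \<open>xy\<close>
  stays deleted, as \<open>g4\<close> requires.\<close>

lemma planar_attach_corner:
  assumes G: "plane_embedding G p c" and simple: "simple_graph G"
    and path: "path3_in_face_boundary G p c x y z"
    and m: "m \<notin> verts G" "m' \<notin> verts G" "m \<noteq> m'"
  shows "planar \<lparr>verts = verts G \<union> {m, m'}, edges = edges G - {{x, y}}
     \<union> {{m, x}, {m, y}, {m, z}, {m', m}, {m', y}, {m', z}}\<rparr>"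
proof -
  obtain F where F: "F \<in> faces G p c" "path_image (c {x, y}) \<subseteq> frontier F" "path_image (c {y, z}) \<subseteq> frontier F"
    and E: "{x, y} \<in> edges G" "{y, z} \<in> edges G" and d: "distinct [x, y, z]"
    using path by (auto simp: path3_in_face_boundary_def)
  have V: "x \<in> verts G" "y \<in> verts G" "z \<in> verts G"
    using simple_graph_edgeD[OF simple E(1)] simple_graph_edgeD[OF simple E(2)] by auto
  have no: "e \<noteq> {v, m}" "e \<noteq> {v, m'}" "e \<noteq> {m, v}" "e \<noteq> {m', v}" "m \<notin> e" "m' \<notin> e" if "e \<in> edges G" for e v
    using that simple m by (auto simp: simple_graph_def)
  have ne: "x \<noteq> m" "x \<noteq> m'" "y \<noteq> m" "y \<noteq> m'" "z \<noteq> m" "z \<noteq> m'" using V m by auto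
  let ?V = "verts G \<union> {m, m'}"
  have xy_yz: "{x, y} \<noteq> {y, z}" using d by (auto simp: doubleton_eq_iff)
  define E1 where "E1 = edges G - {{x, y}, {y, z}} \<union> {{m, x}, {m, y}, {m', y}, {m', m}, {m', z}}"
  have "{{x, m}, {m, y}, {y, m'}, {m', z}, {m, m'}} = {{m, x}, {m, y}, {m', y}, {m', m}, {m', z}}"
    by (auto simp: insert_commute)
  then have p1: "planar \<lparr>verts = ?V, edges = E1\<rparr>"
    using planar_subdivide_and_join[OF G simple E xy_yz F m] unfolding E1_def by simp
  have "finite ?V" "\<And>e. e \<in> edges G \<Longrightarrow> e \<subseteq> verts G \<and> card e = 2" using simple by (auto simp: simple_graph_def)
  then have s1: "simple_graph \<lparr>verts = ?V, edges = E1\<rparr>"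
    using V ne m unfolding simple_graph_def E1_def by auto
  have star1: "{e \<in> E1. m' \<in> e} = {{m', y}, {m', m}, {m', z}}"
  proof -
    have "{e \<in> E1. m' \<in> e} = {e \<in> {{m, x}, {m, y}, {m', y}, {m', m}, {m', z}}. m' \<in> e}"
      using no(6) unfolding E1_def by (intro edges_at_Un) auto
    also have "\<dots> = {{m', y}, {m', m}, {m', z}}" using ne m(3) by auto
    finally show ?thesis .
  qed
  have "{y, z} \<notin> E1" using ne d unfolding E1_def by (auto simp: doubleton_eq_iff)
  \<comment> \<open>The slit is \<open>y m' z\<close>, with \<open>m\<close> as the third neighbour;
    in \<open>p3\<close> it is \<open>m m' z\<close>, with \<open>y\<close> as the third.\<close>
  then have p2: "planar \<lparr>verts = ?V, edges = insert {y, z} E1\<rparr>"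
    using planar_insert_edge_at_degree_3[OF s1 p1, of m' y m z] star1 ne m d by simp
  have s2: "simple_graph \<lparr>verts = ?V, edges = insert {y, z} E1\<rparr>"
    using simple_graph_insert_edge[OF s1, of y z] V d by simp
  have star2: "{e \<in> insert {y, z} E1. m' \<in> e} = {{m', m}, {m', y}, {m', z}}"
  proof -
    have "{e \<in> insert {y, z} E1. m' \<in> e} = {e \<in> E1. m' \<in> e}" using ne by auto
    then show ?thesis unfolding star1 by (simp add: insert_commute)
  qed
  have "{m, z} \<notin> insert {y, z} E1"
    using no ne d m(3) unfolding E1_def by (auto simp: doubleton_eq_iff)
  then have p3: "planar \<lparr>verts = ?V, edges = insert {m, z} (insert {y, z} E1)\<rparr>"
    using planar_insert_edge_at_degree_3[OF s2 p2, of m' m y z] star2 ne m d by simp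
  then show ?thesis
    by (rule planar_subgraph) (auto simp: E1_def)
qed

text \<open>Gluing at \<open>m\<close> and \<open>n\<close> produces the edges \<open>u1 v1\<close>,
  \<open>u2 v3\<close> and \<open>u3 n'\<close>. The remaining two new edges start at
  \<open>u3\<close> and run along \<open>n'\<close>, whose neighbours are \<open>v2\<close>,
  \<open>v3\<close>, \<open>u3\<close>; finally \<open>n'\<close> is dropped.\<close>

lemma planar_g4_fresh:
  fixes G1 G2 :: "'a sgraph" and m m' n n' :: 'a
  assumes G1: "plane_embedding G1 p1 c1" and G2: "plane_embedding G2 p2 c2"
    and simple: "simple_graph G1" "simple_graph G2"
    and V: "verts G1 \<inter> verts G2 = {}"
    and path1: "path3_in_face_boundary G1 p1 c1 u1 u2 u3"
    and path2: "path3_in_face_boundary G2 p2 c2 v1 v2 v3"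
    and fresh: "{m, m', n, n'} \<inter> (verts G1 \<union> verts G2) = {}" and dist: "distinct [m, m', n, n']"
  shows "planar (g4 G1 G2 u1 u2 u3 v1 v2 v3)"
proof -
  have E: "{u1, u2} \<in> edges G1" "{u2, u3} \<in> edges G1" "{v1, v2} \<in> edges G2" "{v2, v3} \<in> edges G2"
    and d: "distinct [u1, u2, u3]" "distinct [v1, v2, v3]"
    using path1 path2 by (auto simp: path3_in_face_boundary_def)
  have U: "u1 \<in> verts G1" "u2 \<in> verts G1" "u3 \<in> verts G1" "v1 \<in> verts G2" "v2 \<in> verts G2" "v3 \<in> verts G2"
    using simple_graph_edgeD[OF simple(1) E(1)] simple_graph_edgeD[OF simple(1) E(2)]
      simple_graph_edgeD[OF simple(2) E(3)] simple_graph_edgeD[OF simple(2) E(4)] by auto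
  have e1: "e \<subseteq> verts G1 \<and> card e = 2" if "e \<in> edges G1" for e using simple(1) that by (simp add: simple_graph_def)
  have e2: "e \<subseteq> verts G2 \<and> card e = 2" if "e \<in> edges G2" for e using simple(2) that by (simp add: simple_graph_def)
  have fin: "finite (verts G1)" "finite (verts G2)" using simple by (auto simp: simple_graph_def)
  have no1: "m \<notin> e" "n \<notin> e" "n' \<notin> e" if "e \<in> edges G1" for e using e1[OF that] fresh by auto
  have no2: "m \<notin> e" "n \<notin> e" "n' \<notin> e" if "e \<in> edges G2" for e using e2[OF that] fresh by auto
  have ne: "m \<noteq> u" "m' \<noteq> u" "n \<noteq> u" "n' \<noteq> u" if "u \<in> verts G1 \<union> verts G2" for u using that fresh by auto
  note ne_u = ne[OF UnI1[OF U(1)]] ne[OF UnI1[OF U(2)]] ne[OF UnI1[OF U(3)]]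
  note ne_v = ne[OF UnI2[OF U(4)]] ne[OF UnI2[OF U(5)]] ne[OF UnI2[OF U(6)]]
  have uv: "u \<noteq> v" if "u \<in> verts G1" "v \<in> verts G2" for u v using that V by auto

  define E1 where "E1 = edges G1 - {{u1, u2}} \<union> {{m, u1}, {m, u2}, {m, u3}}"
  let ?H1 = "\<lparr>verts = insert m (verts G1), edges = E1\<rparr>"
  have "planar \<lparr>verts = verts G1 \<union> {m, m'}, edges = edges G1 - {{u1, u2}}
     \<union> {{m, u1}, {m, u2}, {m, u3}, {m', m}, {m', u2}, {m', u3}}\<rparr>"
    using fresh dist by (intro planar_attach_corner[OF G1 simple(1) path1]) auto
  then have pl1: "planar ?H1" by (rule planar_subgraph) (auto simp: E1_def)
  have s1: "simple_graph ?H1"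
    using fin e1 U ne_u unfolding simple_graph_def E1_def by auto
  have star1: "{e \<in> edges ?H1. m \<in> e} = {{m, u1}, {m, u2}, {m, u3}}"
    using no1 by (auto simp: E1_def)

  \<comment> \<open>The edge from \<open>n\<close> to \<open>v2\<close> is given up, which leaves
    \<open>n\<close> with degree three; \<open>v2\<close> remains accessible through
    \<open>n'\<close>.\<close>
  define E2 where "E2 = edges G2 - {{v1, v2}} \<union> {{n, v1}, {n, v3}, {n, n'}, {n', v2}, {n', v3}}"
  let ?H2 = "\<lparr>verts = verts G2 \<union> {n, n'}, edges = E2\<rparr>"
  have "planar \<lparr>verts = verts G2 \<union> {n, n'}, edges = edges G2 - {{v1, v2}}
     \<union> {{n, v1}, {n, v2}, {n, v3}, {n', n}, {n', v2}, {n', v3}}\<rparr>"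
    using fresh dist by (intro planar_attach_corner[OF G2 simple(2) path2]) auto
  then have pl2: "planar ?H2" by (rule planar_subgraph) (auto simp: E2_def insert_commute)
  have s2: "simple_graph ?H2"
    using fin e2 U ne_v dist unfolding simple_graph_def E2_def by auto
  have star2: "{e \<in> edges ?H2. n \<in> e} = {{n, v1}, {n, v3}, {n, n'}}"
    using no2 ne_v dist by (auto simp: E2_def)

  define E3 where "E3 = (edges G1 - {{u1, u2}}) \<union> (edges G2 - {{v1, v2}})
     \<union> {{n', v2}, {n', v3}, {n', u3}, {u1, v1}, {u2, v3}}"
  let ?V = "verts G1 \<union> insert n' (verts G2)"
  have VV: "verts ?H1 \<inter> verts ?H2 = {}" using V fresh dist by auto
  \<comment> \<open>The order of these lists decides which severed edges are joined:
    \<open>u1\<close> with \<open>v1\<close>, \<open>u2\<close> with \<open>v3\<close>,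
    \<open>u3\<close> with \<open>n'\<close>.\<close>
  have d1: "distinct [u1, u2, u3]" "distinct [v1, v3, n']" using d ne_v by auto
  have pl3: "planar \<lparr>verts = ?V, edges = E3\<rparr>"
  proof (rule planar_subgraph[OF planar_glue_at_degree_3[OF pl1 pl2 s1 s2 VV star1 d1(1) star2 d1(2)]])
    show "verts \<lparr>verts = ?V, edges = E3\<rparr> \<subseteq> verts \<lparr>verts = verts ?H1 - {m} \<union> (verts ?H2 - {n}),
      edges = {e \<in> edges ?H1. m \<notin> e} \<union> {e \<in> edges ?H2. n \<notin> e} \<union> {{u1, v1}, {u2, v3}, {u3, n'}}\<rparr>"
      using fresh dist by auto
    have gen: "A \<union> B \<union> {a, b, c, d, e} \<subseteq> P \<union> Q \<union> {d, e, c'}"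
      if "A \<subseteq> P" "B \<subseteq> Q" "a \<in> Q" "b \<in> Q" "c = c'" for A B P Q :: "'a set set" and a b c d e c'
      using that by blast
    have "e \<in> E1 \<and> m \<notin> e" if "e \<in> edges G1 - {{u1, u2}}" for e
      using that no1(1)[of e] by (simp add: E1_def)
    then have 1: "edges G1 - {{u1, u2}} \<subseteq> {e \<in> E1. m \<notin> e}" by blast
    have "e \<in> E2 \<and> n \<notin> e" if "e \<in> edges G2 - {{v1, v2}}" for e
      using that no2(2)[of e] by (simp add: E2_def)
    then have 2: "edges G2 - {{v1, v2}} \<subseteq> {e \<in> E2. n \<notin> e}" by blast
    have 3: "{n', v2} \<in> {e \<in> E2. n \<notin> e}" "{n', v3} \<in> {e \<in> E2. n \<notin> e}"
      using ne_v dist by (simp_all add: E2_def)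
    show "edges \<lparr>verts = ?V, edges = E3\<rparr> \<subseteq> edges \<lparr>verts = verts ?H1 - {m} \<union> (verts ?H2 - {n}),
      edges = {e \<in> edges ?H1. m \<notin> e} \<union> {e \<in> edges ?H2. n \<notin> e} \<union> {{u1, v1}, {u2, v3}, {u3, n'}}\<rparr>"
      unfolding E3_def sgraph.simps by (rule gen[OF 1 2 3 insert_commute])
  qed
  have s3: "simple_graph \<lparr>verts = ?V, edges = E3\<rparr>"
    using fin e1 e2 U ne_u ne_v uv[OF U(1,4)] uv[OF U(2,6)] unfolding simple_graph_def E3_def by auto
  have star3: "{e \<in> E3. n' \<in> e} = {{n', v2}, {n', v3}, {n', u3}}"
  proof -
    have "{e \<in> E3. n' \<in> e} = {e \<in> {{n', v2}, {n', v3}, {n', u3}, {u1, v1}, {u2, v3}}. n' \<in> e}"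
      unfolding E3_def by (rule edges_at_Un) (use no1(3) no2(3) in blast)
    also have "\<dots> = {{n', v2}, {n', v3}, {n', u3}}" using ne_u ne_v by auto
    finally show ?thesis .
  qed
  have cross: "{u3, v} \<notin> edges G1" "{u3, v} \<notin> edges G2" if "v \<in> verts G2" for v
    using e1[of "{u3, v}"] e2[of "{u3, v}"] V U(3) that by auto
  have new: "{u3, v} \<notin> E3" if "v \<in> {v2, v3}" for v
    using that cross[of v] U uv[OF U(3)] uv[OF U(1)] uv[OF U(2)] d ne_u ne_v unfolding E3_def
    by (auto simp: doubleton_eq_iff)
  have d32: "v3 \<noteq> v2" using d by auto
  have pl4: "planar \<lparr>verts = ?V, edges = insert {u3, v2} E3\<rparr>"
    using planar_insert_edge_at_degree_3[OF s3 pl3, of n' u3 v3 v2] star3 new[of v2] d d32 ne_u ne_v uv[OF U(3,5)] uv[OF U(3,6)]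
    by (simp add: insert_commute)
  have s4: "simple_graph \<lparr>verts = ?V, edges = insert {u3, v2} E3\<rparr>"
    using simple_graph_insert_edge[OF s3, of u3 v2] U uv[OF U(3,5)] by simp
  have star4: "{e \<in> insert {u3, v2} E3. n' \<in> e} = {{n', u3}, {n', v2}, {n', v3}}"
  proof -
    have "{e \<in> insert {u3, v2} E3. n' \<in> e} = {e \<in> E3. n' \<in> e}" using ne_u ne_v by auto
    then show ?thesis unfolding star3 by (simp add: insert_commute)
  qed
  have "{u3, v3} \<notin> insert {u3, v2} E3" using new[of v3] d uv[OF U(3,5)] by (auto simp: doubleton_eq_iff)
  then have pl5: "planar \<lparr>verts = ?V, edges = insert {u3, v3} (insert {u3, v2} E3)\<rparr>"
    using planar_insert_edge_at_degree_3[OF s4 pl4, of n' u3 v2 v3] star4 d ne_u ne_v uv[OF U(3,5)] uv[OF U(3,6)]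
    by simp
  have "edges (g4 G1 G2 u1 u2 u3 v1 v2 v3) \<subseteq> insert {u3, v3} (insert {u3, v2} E3)"
    unfolding E3_def g4_def by auto
  then show ?thesis by (intro planar_subgraph[OF pl5]) (auto simp: g4_def)
qed

lemma map_graph_g4:
  assumes "inj f"
  shows "map_graph f (g4 G1 G2 u1 u2 u3 v1 v2 v3)
    = g4 (map_graph f G1) (map_graph f G2) (f u1) (f u2) (f u3) (f v1) (f v2) (f v3)"
proof -
  have "inj ((`) f)" using assms by (simp add: inj_image_eq_iff inj_on_def)
  then show ?thesis
    by (simp add: map_graph_def g4_def image_Un image_set_diff)
qed

lemma planar_g4:
  fixes G1 G2 :: "'a sgraph"
  assumes G1: "plane_embedding G1 p1 c1" and G2: "plane_embedding G2 p2 c2"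
    and simple: "simple_graph G1" "simple_graph G2"
    and V: "verts G1 \<inter> verts G2 = {}"
    and path1: "path3_in_face_boundary G1 p1 c1 u1 u2 u3"
    and path2: "path3_in_face_boundary G2 p2 c2 v1 v2 v3"
  shows "planar (g4 G1 G2 u1 u2 u3 v1 v2 v3)"
proof -
  let ?f = "Inl :: 'a \<Rightarrow> 'a + nat"
  have f: "inj ?f" by simp
  define q where "q = (\<lambda>p :: 'a \<Rightarrow> complex. p \<circ> inv ?f)"
  define d where "d = (\<lambda>c :: 'a set \<Rightarrow> real \<Rightarrow> complex. \<lambda>e. c (inv ?f ` e))"
  have qd: "q p \<circ> ?f = p" "(\<lambda>e. d c (?f ` e)) = c" for p c
    using f by (simp_all add: q_def d_def fun_eq_iff image_inv_f_f)
  have "planar (g4 (map_graph ?f G1) (map_graph ?f G2) (Inl u1) (Inl u2) (Inl u3) (Inl v1) (Inl v2) (Inl v3))"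
  proof (rule planar_g4_fresh)
    show "plane_embedding (map_graph ?f G1) (q p1) (d c1)" "plane_embedding (map_graph ?f G2) (q p2) (d c2)"
      using G1 G2 by (simp_all only: plane_embedding_map_graph[OF f] qd)
    show "simple_graph (map_graph ?f G1)" "simple_graph (map_graph ?f G2)"
      using simple by (simp_all add: simple_graph_map_graph)
    show "verts (map_graph ?f G1) \<inter> verts (map_graph ?f G2) = {}" using V by auto
    show "path3_in_face_boundary (map_graph ?f G1) (q p1) (d c1) (Inl u1) (Inl u2) (Inl u3)"
      "path3_in_face_boundary (map_graph ?f G2) (q p2) (d c2) (Inl v1) (Inl v2) (Inl v3)"
      using path1 path2 by (intro path3_map_graph[OF f], simp only: qd)+
    show "{Inr 0, Inr 1, Inr 2, Inr 3} \<inter> (verts (map_graph ?f G1) \<union> verts (map_graph ?f G2)) = {}" by auto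
    show "distinct [Inr 0, Inr 1, Inr 2, Inr (3 :: nat) :: 'a + nat]" by simp
  qed
  then show ?thesis
    unfolding map_graph_g4[OF f, symmetric] planar_def plane_embedding_map_graph[OF f] by blast
qed

section \<open>Criticality\<close>

definition proper_3_colouring :: "'a sgraph \<Rightarrow> ('a \<Rightarrow> nat) \<Rightarrow> bool" where
  "proper_3_colouring G f \<longleftrightarrow> (\<forall>v\<in>verts G. f v < 3) \<and> (\<forall>x y. {x, y} \<in> edges G \<longrightarrow> f x \<noteq> f y)"

lemma colorable_3_iff: "colorable G 3 \<longleftrightarrow> (\<exists>f. proper_3_colouring G f)"
  by (simp add: colorable_def proper_3_colouring_def)

lemma colorable_mono:
  assumes "colorable G j" "j \<le> k"
  shows "colorable G k"
  using assms unfolding colorable_def by (meson less_le_trans)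

text \<open>Numbering the finitely many vertices injectively is a colouring. It ensures that the
  \<open>LEAST\<close> in \<open>chromatic_number\<close> is attained.\<close>

lemma colorable_ex:
  assumes "simple_graph G"
  shows "\<exists>k. colorable G k"
proof -
  obtain f :: "'a \<Rightarrow> nat" where f: "inj_on f (verts G)" "f ` verts G = {0..<card (verts G)}"
    using assms ex_bij_betw_finite_nat[of "verts G"] by (auto simp: simple_graph_def bij_betw_def)
  have "f x \<noteq> f y" if "{x, y} \<in> edges G" for x y
    using simple_graph_edgeD[OF assms that] f(1) by (auto dest: inj_onD)
  then show ?thesis using f(2) unfolding colorable_def by (intro exI[of _ "card (verts G)"] exI[of _ f]) auto
qed

lemma chromatic_number_eq_4_iff:
  assumes "simple_graph G"
  shows "chromatic_number G = 4 \<longleftrightarrow> colorable G 4 \<and> \<not> colorable G 3"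
proof
  assume eq: "chromatic_number G = 4"
  have "colorable G (chromatic_number G)"
    unfolding chromatic_number_def using colorable_ex[OF assms] by (rule LeastI_ex)
  moreover have "\<not> colorable G 3"
    using not_less_Least[of 3 "colorable G"] eq by (simp add: chromatic_number_def)
  ultimately show "colorable G 4 \<and> \<not> colorable G 3" using eq by simp
next
  assume *: "colorable G 4 \<and> \<not> colorable G 3"
  show "chromatic_number G = 4"
    unfolding chromatic_number_def
  proof (rule Least_equality)
    show "colorable G 4" using * ..
    show "4 \<le> k" if "colorable G k" for k
      using * colorable_mono[OF that, of 3] by linarith
  qed
qed

text \<open>Two transpositions of colours suffice: the first takes \<open>f x\<close> to
  \<open>s\<close>; the second takes the resulting colour of \<open>y\<close> to \<open>t\<close>
  and fixes \<open>s\<close>.\<close>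

lemma proper_3_colouring_recolor:
  assumes f: "proper_3_colouring G f" and xy: "x \<in> verts G" "y \<in> verts G" "f x \<noteq> f y"
    and st: "s < 3" "t < 3" "s \<noteq> t"
  obtains g where "proper_3_colouring G g" "\<And>v w. g v = g w \<longleftrightarrow> f v = f w" "g x = s" "g y = t"
proof -
  have fxy: "f x \<in> {..<3}" "f y \<in> {..<3}" using f xy by (auto simp: proper_3_colouring_def)
  have "\<exists>\<pi> :: nat \<Rightarrow> nat. \<pi> permutes {..<3} \<and> \<pi> (f x) = s \<and> \<pi> (f y) = t"
  proof -
    let ?\<tau> = "Transposition.transpose (f x) s"
    let ?\<pi> = "Transposition.transpose (?\<tau> (f y)) t \<circ> ?\<tau>"
    have 1: "?\<tau> permutes {..<3}" using fxy st by (intro permutes_swap_id) auto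
    have "?\<tau> (f y) \<in> {..<3}" using permutes_in_image[OF 1] fxy by simp
    then have "Transposition.transpose (?\<tau> (f y)) t permutes {..<3}" using st by (intro permutes_swap_id) auto
    then have "?\<pi> permutes {..<3}" using 1 by (rule permutes_compose[rotated])
    moreover have "?\<pi> (f x) = s" using xy st by (auto simp: Transposition.transpose_def)
    moreover have "?\<pi> (f y) = t" by simp
    ultimately show ?thesis by blast
  qed
  then obtain \<pi> where \<pi>: "\<pi> permutes {..<3}" "\<pi> (f x) = s" "\<pi> (f y) = t" by blast
  have inj: "\<pi> a = \<pi> b \<longleftrightarrow> a = b" for a b using permutes_inj[OF \<pi>(1)] by (rule inj_eq)
  have "\<pi> a < 3" if "a < 3" for a using permutes_in_image[OF \<pi>(1), of a] that by simp
  then have "proper_3_colouring G (\<pi> \<circ> f)" using f inj by (auto simp: proper_3_colouring_def)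
  then show ?thesis using that[of "\<pi> \<circ> f"] inj \<pi> by simp
qed

lemma verts_delete_edge [simp]: "verts (delete_edge G e) = verts G"
  and edges_delete_edge [simp]: "edges (delete_edge G e) = edges G - {e}"
  by (simp_all add: delete_edge_def)

lemma four_critical_iff:
  assumes "simple_graph G"
  shows "four_critical G \<longleftrightarrow>
    colorable G 4 \<and> \<not> colorable G 3 \<and> (\<forall>e\<in>edges G. colorable (delete_edge G e) 3)"
  by (simp add: four_critical_def chromatic_number_eq_4_iff[OF assms])

text \<open>One end of the deleted edge receives the fourth colour 3, which no other vertex
  has.\<close>

lemma colorable_4_if_delete_edge:
  assumes simple: "simple_graph G" and xy: "{x, y} \<in> edges G"
    and col: "colorable (delete_edge G {x, y}) 3"
  shows "colorable G 4"
proof -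
  obtain f where f: "proper_3_colouring (delete_edge G {x, y}) f" using col by (auto simp: colorable_3_iff)
  have V: "f v < 3" if "v \<in> verts G" for v using f that by (simp add: proper_3_colouring_def)
  have "(f(x := 3)) a \<noteq> (f(x := 3)) b" if "{a, b} \<in> edges G" for a b
  proof -
    note ab = simple_graph_edgeD[OF simple that]
    show ?thesis
    proof (cases "{a, b} = {x, y}")
      case True
      then show ?thesis using ab V[of a] V[of b] by (auto simp: doubleton_eq_iff)
    next
      case False
      then have "f a \<noteq> f b" using f that by (simp add: proper_3_colouring_def)
      then show ?thesis using ab V[of a] V[of b] by auto
    qed
  qed
  moreover have "(f(x := 3)) v < 4" if "v \<in> verts G" for v using V[OF that] by simp
  ultimately show ?thesis unfolding colorable_def by blast
qed

section \<open>Colourings after the deletion of an edge\<close>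

text \<open>With different colours at \<open>x\<close> and \<open>y\<close> the colouring would also
  be proper on \<open>G\<close>.\<close>

lemma critical_colouring_ends_equal:
  assumes "\<not> colorable G 3" "proper_3_colouring (delete_edge G {x, y}) f"
  shows "f x = f y"
proof (rule ccontr)
  assume ne: "f x \<noteq> f y"
  have "f a \<noteq> f b" if "{a, b} \<in> edges G" for a b
  proof (cases "{a, b} = {x, y}")
    case True
    then show ?thesis using ne by (auto simp: doubleton_eq_iff)
  next
    case False
    then show ?thesis using assms(2) that by (simp add: proper_3_colouring_def)
  qed
  then have "proper_3_colouring G f" using assms(2) by (simp add: proper_3_colouring_def)
  then show False using assms(1) by (auto simp: colorable_3_iff)
qed

text \<open>The ends of the deleted edge agree, and the surviving edge \<open>yz\<close> separates
  \<open>z\<close> from them, so a permutation of the colours gives the pattern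
  \<open>s, s, t\<close>.\<close>

lemma critical_colouring_first_edge:
  assumes simple: "simple_graph G" and crit: "four_critical G"
    and E: "{x, y} \<in> edges G" "{y, z} \<in> edges G" "distinct [x, y, z]"
    and st: "s < 3" "t < 3" "s \<noteq> t"
  obtains f where "proper_3_colouring (delete_edge G {x, y}) f" "f x = s" "f y = s" "f z = t"
proof -
  let ?G = "delete_edge G {x, y}"
  have c: "\<not> colorable G 3" "colorable ?G 3" using crit E(1) four_critical_iff[OF simple] by auto
  obtain f where f: "proper_3_colouring ?G f" using c(2) by (auto simp: colorable_3_iff)
  have "{y, z} \<in> edges ?G" using E by (auto simp: doubleton_eq_iff)
  then have "f y \<noteq> f z" using f by (simp add: proper_3_colouring_def)
  moreover have "y \<in> verts ?G" "z \<in> verts ?G" using simple_graph_edgeD[OF simple E(2)] by simp_all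
  ultimately obtain g where g: "proper_3_colouring ?G g" "g y = s" "g z = t"
    using proper_3_colouring_recolor[OF f _ _ _ st] by metis
  then show ?thesis using that critical_colouring_ends_equal[OF c(1) g(1)] by metis
qed

text \<open>Here \<open>xy\<close> survives the deletion, so the colours of its ends differ and can
  be prescribed.\<close>

lemma critical_colouring_other_edge:
  assumes simple: "simple_graph G" and crit: "four_critical G"
    and E: "{x, y} \<in> edges G" "e \<in> edges G" "e \<noteq> {x, y}"
    and st: "s < 3" "t < 3" "s \<noteq> t"
  obtains f where "proper_3_colouring (delete_edge G e) f" "f x = s" "f y = t"
proof -
  let ?G = "delete_edge G e"
  have "colorable ?G 3" using crit E(2) four_critical_iff[OF simple] by auto
  then obtain f where f: "proper_3_colouring ?G f" by (auto simp: colorable_3_iff)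
  have "{x, y} \<in> edges ?G" using E by auto
  then have "f x \<noteq> f y" using f by (simp add: proper_3_colouring_def)
  moreover have "x \<in> verts ?G" "y \<in> verts ?G" using simple_graph_edgeD[OF simple E(1)] by simp_all
  ultimately show ?thesis using proper_3_colouring_recolor[OF f _ _ _ st] that by metis
qed

text \<open>The two colourings have disjoint domains, so only the edges across can cause conflicts.
  They are given as ordered pairs \<open>C\<close> to keep track of the side of each end.\<close>

lemma colorable_disjoint_union:
  assumes V: "verts G1 \<inter> verts G2 = {}"
    and E: "\<And>e. e \<in> edges G1 \<Longrightarrow> e \<subseteq> verts G1" "\<And>e. e \<in> edges G2 \<Longrightarrow> e \<subseteq> verts G2"
    and f: "proper_3_colouring G1 f" and g: "proper_3_colouring G2 g"
    and C: "\<And>u v. (u, v) \<in> C \<Longrightarrow> u \<in> verts G1 \<and> v \<in> verts G2 \<and> f u \<noteq> g v"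
    and H: "verts H \<subseteq> verts G1 \<union> verts G2" "edges H \<subseteq> edges G1 \<union> edges G2 \<union> (\<lambda>(u, v). {u, v}) ` C"
  shows "colorable H 3"
proof -
  define h where "h = (\<lambda>v. if v \<in> verts G1 then f v else g v)"
  have h1: "h v = f v" if "v \<in> verts G1" for v using that by (simp add: h_def)
  have h2: "h v = g v" if "v \<in> verts G2" for v using that V by (auto simp: h_def)
  have "h a \<noteq> h b" if ab: "{a, b} \<in> edges H" for a b
  proof -
    consider "{a, b} \<in> edges G1" | "{a, b} \<in> edges G2" | u v where "(u, v) \<in> C" "{a, b} = {u, v}"
      using ab H(2) by auto
    then show ?thesis
    proof cases
      case 1
      then show ?thesis using E(1)[OF 1] h1 f by (simp add: proper_3_colouring_def)
    next
      case 2
      then show ?thesis using E(2)[OF 2] h2 g by (simp add: proper_3_colouring_def)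
    next
      case 3
      then show ?thesis using C[OF 3(1)] h1[of u] h2[of v] by (auto simp: doubleton_eq_iff)
    qed
  qed
  moreover have "h v < 3" if "v \<in> verts H" for v
    using that H(1) h1[of v] h2[of v] f g by (auto simp: proper_3_colouring_def)
  ultimately show ?thesis unfolding colorable_def by blast
qed

lemma simple_graph_g4:
  assumes "simple_graph G1" "simple_graph G2" "verts G1 \<inter> verts G2 = {}"
    and "u1 \<in> verts G1" "u2 \<in> verts G1" "u3 \<in> verts G1" "v1 \<in> verts G2" "v2 \<in> verts G2" "v3 \<in> verts G2"
  shows "simple_graph (g4 G1 G2 u1 u2 u3 v1 v2 v3)"
proof -
  have ne: "u \<noteq> v" if "u \<in> verts G1" "v \<in> verts G2" for u v using that assms(3) by auto
  have "e \<subseteq> verts G1 \<union> verts G2 \<and> card e = 2" if "e \<in> edges G1 \<union> edges G2" for e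
    using that assms(1,2) by (auto simp: simple_graph_def)
  moreover have "e \<subseteq> verts G1 \<union> verts G2 \<and> card e = 2" if "e \<in> {{u1, v1}, {u2, v3}, {u3, v2}, {u3, v3}}" for e
    using that assms(4-9) ne by auto
  moreover have "finite (verts G1 \<union> verts G2)" using assms(1,2) by (simp add: simple_graph_def)
  moreover have "e \<in> edges G1 \<union> edges G2 \<or> e \<in> {{u1, v1}, {u2, v3}, {u3, v2}, {u3, v3}}"
    if "e \<in> edges (g4 G1 G2 u1 u2 u3 v1 v2 v3)" for e
    using that unfolding g4_def by simp blast
  moreover have "verts (g4 G1 G2 u1 u2 u3 v1 v2 v3) = verts G1 \<union> verts G2" by (simp add: g4_def)
  ultimately show ?thesis
    unfolding simple_graph_def by metis
qed

text \<open>If the deleted edge lies in one of the given graphs, that side is coloured with its path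
  edge \<open>u1 u2\<close> or \<open>v1 v2\<close> still present, and the pattern
  \<open>s, s, t\<close> on the other path is adapted to it. If it is one of the four new edges,
  both sides have such a pattern.\<close>

lemma four_critical_g4:
  assumes simple: "simple_graph G1" "simple_graph G2" and V: "verts G1 \<inter> verts G2 = {}"
    and crit: "four_critical G1" "four_critical G2"
    and U: "{u1, u2} \<in> edges G1" "{u2, u3} \<in> edges G1" "distinct [u1, u2, u3]"
    and W: "{v1, v2} \<in> edges G2" "{v2, v3} \<in> edges G2" "distinct [v1, v2, v3]"
  shows "four_critical (g4 G1 G2 u1 u2 u3 v1 v2 v3)"
proof -
  let ?G = "g4 G1 G2 u1 u2 u3 v1 v2 v3"
  let ?D1 = "delete_edge G1 {u1, u2}" and ?D2 = "delete_edge G2 {v1, v2}"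
  let ?C = "{(u1, v1), (u2, v3), (u3, v2), (u3, v3)}"
  have in_V: "u1 \<in> verts G1" "u2 \<in> verts G1" "u3 \<in> verts G1" "v1 \<in> verts G2" "v2 \<in> verts G2" "v3 \<in> verts G2"
    using simple_graph_edgeD[OF simple(1) U(1)] simple_graph_edgeD[OF simple(1) U(2)]
      simple_graph_edgeD[OF simple(2) W(1)] simple_graph_edgeD[OF simple(2) W(2)] by auto
  have sG: "simple_graph ?G" using simple_graph_g4[OF simple V in_V] .
  have nc: "\<not> colorable G1 3" "\<not> colorable G2 3" using crit simple by (simp_all add: four_critical_iff)
  have sub: "e \<subseteq> verts G1" if "e \<in> edges G1" for e using simple(1) that by (simp add: simple_graph_def)
  have sub': "e \<subseteq> verts G2" if "e \<in> edges G2" for e using simple(2) that by (simp add: simple_graph_def)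
  have EG: "edges ?G = edges ?D1 \<union> edges ?D2 \<union> (\<lambda>(u, v). {u, v}) ` ?C"
  proof -
    have "{v1, v2} \<notin> edges G1" "{u1, u2} \<notin> edges G2" using sub sub' in_V V by blast+
    then have "edges G1 \<union> edges G2 - {{u1, u2}, {v1, v2}} = (edges G1 - {{u1, u2}}) \<union> (edges G2 - {{v1, v2}})"
      by auto
    then show ?thesis by (simp add: g4_def)
  qed
  have VG: "verts ?G = verts G1 \<union> verts G2" by (simp add: g4_def)
  have union: "colorable H 3"
    if "proper_3_colouring (delete_edge G1 e1) f" "proper_3_colouring (delete_edge G2 e2) g"
      "\<And>u v. (u, v) \<in> C \<Longrightarrow> f u \<noteq> g v" "C \<subseteq> ?C" "verts H \<subseteq> verts ?G"
      "edges H \<subseteq> edges (delete_edge G1 e1) \<union> edges (delete_edge G2 e2) \<union> (\<lambda>(u, v). {u, v}) ` C"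
    for H e1 f e2 g C
  proof (rule colorable_disjoint_union[OF _ _ _ that(1,2) _ _ that(6)])
    show "verts (delete_edge G1 e1) \<inter> verts (delete_edge G2 e2) = {}" using V by simp
    show "e \<subseteq> verts (delete_edge G1 e1)" if "e \<in> edges (delete_edge G1 e1)" for e using sub that by simp
    show "e \<subseteq> verts (delete_edge G2 e2)" if "e \<in> edges (delete_edge G2 e2)" for e using sub' that by simp
    show "u \<in> verts (delete_edge G1 e1) \<and> v \<in> verts (delete_edge G2 e2) \<and> f u \<noteq> g v" if "(u, v) \<in> C" for u v
      using \<open>C \<subseteq> ?C\<close> \<open>\<And>u v. (u, v) \<in> C \<Longrightarrow> f u \<noteq> g v\<close> that in_V by auto
    show "verts H \<subseteq> verts (delete_edge G1 e1) \<union> verts (delete_edge G2 e2)"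
      using that(5) VG by simp
  qed
  \<comment> \<open>The paths are coloured \<open>0, 0, 1\<close> and \<open>s, s, t\<close>;
    \<open>ne\<close> expresses that the three new edges other than \<open>{a, b}\<close> are
    properly coloured.\<close>
  have cross: "colorable (delete_edge ?G {a, b}) 3"
    if ab: "(a, b) \<in> ?C" and st: "s < 3" "t < 3" "s \<noteq> t"
      and ne: "\<And>u v. (u, v) \<in> ?C - {(a, b)} \<Longrightarrow>
        (if u = u3 then 1 else 0 :: nat) \<noteq> (if v = v3 then t else s)" for a b s t
  proof -
    obtain f where f: "proper_3_colouring ?D1 f" "f u1 = 0" "f u2 = 0" "f u3 = 1"
      by (rule critical_colouring_first_edge[OF simple(1) crit(1) U, of 0 1]) auto
    obtain g where g: "proper_3_colouring ?D2 g" "g v1 = s" "g v2 = s" "g v3 = t"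
      by (rule critical_colouring_first_edge[OF simple(2) crit(2) W st])
    have fv: "f u = (if u = u3 then 1 else 0)" if "u \<in> {u1, u2, u3}" for u using f U(3) that by auto
    have gv: "g v = (if v = v3 then t else s)" if "v \<in> {v1, v2, v3}" for v using g W(3) that by auto
    show ?thesis
    proof (rule union[OF f(1) g(1), of "?C - {(a, b)}"])
      show "f u \<noteq> g v" if "(u, v) \<in> ?C - {(a, b)}" for u v
        using ne[OF that] that fv[of u] gv[of v] by auto
      show "edges (delete_edge ?G {a, b}) \<subseteq> edges ?D1 \<union> edges ?D2 \<union> (\<lambda>(u, v). {u, v}) ` (?C - {(a, b)})"
        unfolding edges_delete_edge EG by auto
    qed auto
  qed
  have "colorable (delete_edge ?G e) 3" if e: "e \<in> edges ?G" for e
  proof -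
    have "e \<in> edges ?D1 \<or> e \<in> edges ?D2 \<or> e = {u1, v1} \<or> e = {u2, v3} \<or> e = {u3, v2} \<or> e = {u3, v3}"
      using e unfolding EG by (simp only: Un_iff image_insert image_empty case_prod_conv insert_iff empty_iff simp_thms disj_assoc)
    then consider "e \<in> edges ?D1" | "e \<in> edges ?D2" | "e = {u1, v1}" | "e = {u2, v3}" | "e = {u3, v2}" | "e = {u3, v3}"
      by (elim disjE)
    then show ?thesis
    proof cases
      case 1
      then have e1: "e \<in> edges G1" "e \<noteq> {u1, u2}" by auto
      obtain f where f: "proper_3_colouring (delete_edge G1 e) f" "f u1 = 0" "f u2 = 1"
        by (rule critical_colouring_other_edge[OF simple(1) crit(1) U(1) e1, of 0 1]) auto
      have "f u3 < 3" using f(1) in_V by (simp add: proper_3_colouring_def)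
      \<comment> \<open>The four conditions beyond \<open>s \<noteq> t\<close> and the range are
        exactly those imposed by the new edges if \<open>v1\<close>, \<open>v2\<close> get
        \<open>s\<close> and \<open>v3\<close> gets \<open>t\<close>.\<close>
      then obtain s t where st: "s < 3" "t < 3" "s \<noteq> t" "s \<noteq> 0" "t \<noteq> 1" "s \<noteq> f u3" "t \<noteq> f u3"
      proof -
        consider "f u3 = 0" | "f u3 = 1" | "f u3 = 2" using \<open>f u3 < 3\<close> by linarith
        then show ?thesis
        proof cases
          case 1 then show ?thesis using that[of 1 2] by simp
        next
          case 2 then show ?thesis using that[of 2 0] by simp
        next
          case 3 then show ?thesis using that[of 1 0] by simp
        qed
      qed
      obtain g where g: "proper_3_colouring ?D2 g" "g v1 = s" "g v2 = s" "g v3 = t"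
        by (rule critical_colouring_first_edge[OF simple(2) crit(2) W st(1-3)])
      show ?thesis
      proof (rule union[OF f(1) g(1), of ?C])
        show "f u \<noteq> g v" if "(u, v) \<in> ?C" for u v using that f g st by auto
        show "edges (delete_edge ?G e) \<subseteq> edges (delete_edge G1 e) \<union> edges ?D2 \<union> (\<lambda>(u, v). {u, v}) ` ?C"
          unfolding edges_delete_edge EG by auto
      qed auto
    next
      case 2
      then have e2: "e \<in> edges G2" "e \<noteq> {v1, v2}" by auto
      obtain g where g: "proper_3_colouring (delete_edge G2 e) g" "g v1 = 0" "g v2 = 1"
        by (rule critical_colouring_other_edge[OF simple(2) crit(2) W(1) e2, of 0 1]) auto
      have "g v3 < 3" using g(1) in_V by (simp add: proper_3_colouring_def)
      \<comment> \<open>The same conditions arise from the other side, now with \<open>s\<close> on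
        \<open>u1\<close>, \<open>u2\<close> and \<open>t\<close> on \<open>u3\<close>.\<close>
      then obtain s t where st: "s < 3" "t < 3" "s \<noteq> t" "s \<noteq> 0" "t \<noteq> 1" "s \<noteq> g v3" "t \<noteq> g v3"
      proof -
        consider "g v3 = 0" | "g v3 = 1" | "g v3 = 2" using \<open>g v3 < 3\<close> by linarith
        then show ?thesis
        proof cases
          case 1 then show ?thesis using that[of 1 2] by simp
        next
          case 2 then show ?thesis using that[of 2 0] by simp
        next
          case 3 then show ?thesis using that[of 1 0] by simp
        qed
      qed
      obtain f where f: "proper_3_colouring ?D1 f" "f u1 = s" "f u2 = s" "f u3 = t"
        by (rule critical_colouring_first_edge[OF simple(1) crit(1) U st(1-3)])
      show ?thesis
      proof (rule union[OF f(1) g(1), of ?C])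
        show "f u \<noteq> g v" if "(u, v) \<in> ?C" for u v using that f g st by auto
        show "edges (delete_edge ?G e) \<subseteq> edges ?D1 \<union> edges (delete_edge G2 e) \<union> (\<lambda>(u, v). {u, v}) ` ?C"
          unfolding edges_delete_edge EG by auto
      qed auto
    next
      case 3
      \<comment> \<open>In this and the next three cases the pair \<open>s\<close>, \<open>t\<close>
        is chosen so that the deleted edge is the only new edge with equally coloured ends.\<close>
      show ?thesis unfolding 3 by (rule cross[of _ _ 0 2]) (use U(3) W(3) in auto)
    next
      case 4
      show ?thesis unfolding 4 by (rule cross[of _ _ 2 0]) (use U(3) W(3) in auto)
    next
      case 5
      show ?thesis unfolding 5 by (rule cross[of _ _ 1 2]) (use U(3) W(3) in auto)
    next
      case 6
      show ?thesis unfolding 6 by (rule cross[of _ _ 2 1]) (use U(3) W(3) in auto)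
    qed
  qed
  moreover have "\<not> colorable ?G 3"
  proof
    assume "colorable ?G 3"
    then obtain f where f: "proper_3_colouring ?G f" by (auto simp: colorable_3_iff)
    then have fE: "f a \<noteq> f b" if "{a, b} \<in> edges ?G" for a b using that by (simp add: proper_3_colouring_def)
    have "proper_3_colouring ?D1 f" "proper_3_colouring ?D2 f" using f unfolding proper_3_colouring_def EG VG by auto
    \<comment> \<open>With \<open>u1\<close>, \<open>u2\<close> of one colour and \<open>v1\<close>,
      \<open>v2\<close> of one colour, the edge \<open>u1 v1\<close> separates \<open>u2\<close>
      from \<open>v2\<close>. Then \<open>u2\<close>, \<open>u3\<close>, \<open>v2\<close>,
      \<open>v3\<close> have four different colours.\<close>
    then have eq: "f u1 = f u2" "f v1 = f v2" by (simp_all add: critical_colouring_ends_equal[OF nc(1)] critical_colouring_ends_equal[OF nc(2)])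
    have "{u2, u3} \<in> edges ?D1" using U by (auto simp: doubleton_eq_iff)
    moreover have "{v2, v3} \<in> edges ?D2" using W by (auto simp: doubleton_eq_iff)
    ultimately have "f u2 \<noteq> f u3" "f v2 \<noteq> f v3" using fE unfolding EG by auto
    moreover have "f u1 \<noteq> f v1" "f u2 \<noteq> f v3" "f u3 \<noteq> f v2" "f u3 \<noteq> f v3"
      using fE[of u1 v1] fE[of u2 v3] fE[of u3 v2] fE[of u3 v3] unfolding EG by auto
    moreover have "f u2 < 3" "f u3 < 3" "f v2 < 3" "f v3 < 3"
      using f in_V unfolding proper_3_colouring_def VG by auto
    ultimately show False using eq by linarith
  qed
  moreover have "colorable ?G 4"
  proof (rule colorable_4_if_delete_edge[OF sG])
    show "{u1, v1} \<in> edges ?G" by (simp add: EG)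
    then show "colorable (delete_edge ?G {u1, v1}) 3" using calculation(1) by blast
  qed
  ultimately show ?thesis by (simp add: four_critical_iff[OF sG])
qed

theorem theorem2p4:
  fixes G1 G2 :: "'a sgraph"
    and p1 p2 :: "'a \<Rightarrow> complex"
    and c1 c2 :: "'a set \<Rightarrow> real \<Rightarrow> complex"
    and u1 u2 u3 v1 v2 v3 :: 'a
  assumes "simple_graph G1" and "simple_graph G2"
    and "verts G1 \<inter> verts G2 = {}"
    and "four_critical G1" and "four_critical G2"
    and "plane_embedding G1 p1 c1" and "plane_embedding G2 p2 c2"
    and "path3_in_face_boundary G1 p1 c1 u1 u2 u3"
    and "path3_in_face_boundary G2 p2 c2 v1 v2 v3"
  shows "simple_graph (g4 G1 G2 u1 u2 u3 v1 v2 v3)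
       \<and> four_critical (g4 G1 G2 u1 u2 u3 v1 v2 v3)
       \<and> planar (g4 G1 G2 u1 u2 u3 v1 v2 v3)"
proof -
  have U: "{u1, u2} \<in> edges G1" "{u2, u3} \<in> edges G1" "distinct [u1, u2, u3]"
    and W: "{v1, v2} \<in> edges G2" "{v2, v3} \<in> edges G2" "distinct [v1, v2, v3]"
    using assms(8,9) by (simp_all add: path3_in_face_boundary_def)
  have "simple_graph (g4 G1 G2 u1 u2 u3 v1 v2 v3)"
    using simple_graph_edgeD[OF assms(1) U(1)] simple_graph_edgeD[OF assms(1) U(2)]
      simple_graph_edgeD[OF assms(2) W(1)] simple_graph_edgeD[OF assms(2) W(2)]
    by (intro simple_graph_g4 assms(1-3))
  moreover have "four_critical (g4 G1 G2 u1 u2 u3 v1 v2 v3)"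
    by (rule four_critical_g4[OF assms(1-5) U W])
  moreover have "planar (g4 G1 G2 u1 u2 u3 v1 v2 v3)"
    by (rule planar_g4[OF assms(6,7,1-3,8,9)])
  ultimately show ?thesis by blast
qed

end
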